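(* Consider the strict $(1:1)$ Avoider-Enforcer vertex $K_3$-game. Let $\mathcal E^A_{K_3}$ (resp. $\mathcal E^E_{K_3}$) be the graph property of being Enforcer's win in this game when the order of play is such that Avoider (resp. Enforcer) makes the last move, i.e. claims the last free vertex (this is determined by which player moves first and by the parity of the number of vertices). For the random graph process $\tilde G$ on $[n]$, w.h.p. $\tau(\tilde G,\mathcal E^A_{K_3})=\tau(\tilde G,\mathcal G_{DD})$ and $\tau(\tilde G,\mathcal E^E_{K_3})=\tau(\tilde G,\mathcal G_{2DD})$.
   Context: The strict $(1:1)$ Avoider-Enforcer vertex $K_3$-game on a graph $G$: Avoider and Enforcer alternately claim exactly one previously unclaimed vertex of $G$ each until all vertices are claimed; Avoider loses if the subgraph of $G$ induced by his vertices contains a triangle, and wins otherwise. The random graph process $\tilde G=(G_i)$ on $[n]$ adds the edges of $K_n$ one by one in uniformly random order; $\tau(\tilde G,\mathcal P)=\min\{i:G_i\in\mathcal P\}$. A double diamond $DD$ is the graph on vertices $x,y_1,z_1,z_2,y_2,z_3,z_4$ with edges $xy_1,xz_1,xz_2,y_1z_1,y_1z_2,xy_2,xz_3,xz_4,y_2z_3,y_2z_4$. $\mathcal G_{kF}$ is the property of containing $k$ (possibly intersecting) copies of $F$, $\mathcal G_F=\mathcal G_{1F}$. "W.h.p." means with probability tending to 1 as $n\to\infty$. *)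

theory Defs
  imports "HOL-Probability.Probability"
begin

text \<open>Graphs on the vertex set [n] = {0..<n} are represented by their edge sets:
  sets of 2-element subsets of {0..<n}.\<close>

definition Kn_edges :: "nat \<Rightarrow> nat set set" where
  "Kn_edges n = {e. \<exists>a b. a < n \<and> b < n \<and> a \<noteq> b \<and> e = {a, b}}"

definition edge_orderings :: "nat \<Rightarrow> nat set list set" where
  "edge_orderings n = {xs. distinct xs \<and> set xs = Kn_edges n}"

definition random_graph_process :: "nat \<Rightarrow> nat set list pmf" where
  "random_graph_process n = pmf_of_set (edge_orderings n)"

definition process_graph :: "nat set list \<Rightarrow> nat \<Rightarrow> nat set set" where
  "process_graph xs i = set (take i xs)"

definition hitting_time :: "nat set list \<Rightarrow> (nat set set \<Rightarrow> bool) \<Rightarrow> nat option" where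
  "hitting_time xs P =
     (if \<exists>i\<le>length xs. P (process_graph xs i)
      then Some (LEAST i. i \<le> length xs \<and> P (process_graph xs i)) else None)"

text \<open>Copies of a graph F (given by its edge set, no isolated vertices) in G:
  subgraphs of G that are images of F under an injective vertex map into [n].
  A copy is identified with its edge set.\<close>

definition copies :: "nat \<Rightarrow> nat set set \<Rightarrow> nat set set \<Rightarrow> nat set set set" where
  "copies n F G = {(\<lambda>e. f ` e) ` F | f. inj_on f (\<Union>F) \<and> f ` (\<Union>F) \<subseteq> {0..<n}
                                   \<and> (\<lambda>e. f ` e) ` F \<subseteq> G}"

definition has_k_copies :: "nat \<Rightarrow> nat \<Rightarrow> nat set set \<Rightarrow> nat set set \<Rightarrow> bool" where
  "has_k_copies n k F G \<longleftrightarrow> (\<exists>C \<subseteq> copies n F G. finite C \<and> card C = k)"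

text \<open>Double diamond on x=0, y1=1, z1=2, z2=3, y2=4, z3=5, z4=6.\<close>

definition DD :: "nat set set" where
  "DD = {{0,1},{0,2},{0,3},{1,2},{1,3},{0,4},{0,5},{0,6},{4,5},{4,6}}"

text \<open>Strict (1:1) Avoider-Enforcer vertex K_3 game on graph G (edge set E).
  State: free vertices, Avoider's vertices, whose turn (True = Avoider).
  enforcer_wins holds iff Enforcer has a strategy guaranteeing that at the end
  Avoider's vertex set spans a triangle.\<close>

definition has_triangle :: "nat set set \<Rightarrow> nat set \<Rightarrow> bool" where
  "has_triangle E A \<longleftrightarrow> (\<exists>a\<in>A. \<exists>b\<in>A. \<exists>c\<in>A. {a,b} \<in> E \<and> {b,c} \<in> E \<and> {a,c} \<in> E)"

inductive enforcer_wins :: "nat set set \<Rightarrow> nat set \<Rightarrow> nat set \<Rightarrow> bool \<Rightarrow> bool"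
  for E :: "nat set set" where
  finished: "has_triangle E A \<Longrightarrow> enforcer_wins E {} A t"
| avoider_move: "F \<noteq> {} \<Longrightarrow> (\<And>v. v \<in> F \<Longrightarrow> enforcer_wins E (F - {v}) (insert v A) False)
                 \<Longrightarrow> enforcer_wins E F A True"
| enforcer_move: "v \<in> F \<Longrightarrow> enforcer_wins E (F - {v}) A True
                 \<Longrightarrow> enforcer_wins E F A False"

text \<open>E^A_{K3}: Enforcer wins when Avoider makes the last move; on n vertices this
  means Avoider moves first iff n is odd. E^E_{K3}: Enforcer makes the last move,
  i.e. Avoider moves first iff n is even.\<close>

definition EA_K3 :: "nat \<Rightarrow> nat set set \<Rightarrow> bool" where
  "EA_K3 n G \<longleftrightarrow> enforcer_wins G {0..<n} {} (odd n)"

definition EE_K3 :: "nat \<Rightarrow> nat set set \<Rightarrow> bool" where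
  "EE_K3 n G \<longleftrightarrow> enforcer_wins G {0..<n} {} (even n)"

end

theory Submission
  imports Defs "HOL-Combinatorics.Multiset_Permutations" "HOL-Real_Asymp.Real_Asymp"
begin

text \<open>
  Fix the graph at time \<open>m = \<lfloor>n\<^bsup>1.301\<^esup>\<rfloor>\<close>. By the first moment method, w.h.p. every set \<open>S\<close> of at most 30
  vertices satisfies \<open>7 e(S) \<le> 10 |S|\<close>, and by the second moment method there are at least two double
  diamonds. From time \<open>m\<close> on, Enforcer therefore wins by monotonicity; up to time \<open>m\<close>, sparseness
  decides the game, as follows.

  Enforcer, moving second on a single double diamond, forces a triangle (a finite check), and he can
  answer moves elsewhere in pairs; if he has to make the last move overall he needs a second double
  diamond, which is disjoint from the first one by sparseness.
  Conversely, a sparse graph without double diamond has a matching such that every triangle contains a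
  matching edge: clusters of triangles consist of few diamonds and otherwise tree-like triangles. Avoider
  wins by never taking both ends of a matching edge. If there is one double diamond
  and Enforcer moves last, Avoider plays outside it, and as soon as Enforcer takes one of its vertices the
  remaining triangles can be hit by a matching again.
\<close>


section \<open>Strategies for Enforcer and Avoider\<close>

text \<open>At edge density about n^(-7/10), a fixed graph with s vertices and k edges is expected
  to have about n^((10 s - 7 k)/10) copies. So 10 s - 7 k, the excess, decides which graphs occur:
  the double diamond is exactly critical, and local sparseness says that no small set is denser. The
  structural argument spends the excess like a budget. A triangle starts with 9 and a diamond with
  5; a triangle glued on at one vertex costs at least 1, one glued on along an edge at least 4, a
  diamond glued on at one vertex at least 5. Hence a cluster of triangles stops growing after at
  most nine steps, and only few shapes of its dense core need a separate look. The game is strict,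
  so having to move can be a burden, and parity is the obstacle in all strategies. Avoider can use
  pairs directly only when he replies to Enforcer and moves last. When Enforcer moves last, an odd
  set is withheld from play, which Enforcer has to open in the end; for one double diamond this set
  consists of its 7 vertices.\<close>

lemma has_triangle_mono: "has_triangle E A \<Longrightarrow> E \<subseteq> E' \<Longrightarrow> A \<subseteq> A' \<Longrightarrow> has_triangle E' A'"
  unfolding has_triangle_def by (meson subsetD)

lemma enforcer_wins_mono:
  "enforcer_wins E F A t \<Longrightarrow> E \<subseteq> E' \<Longrightarrow> A \<subseteq> A' \<Longrightarrow> enforcer_wins E' F A' t"
proof (induction arbitrary: A' rule: enforcer_wins.induct)
  case (finished A t)
  then show ?case
    by (intro enforcer_wins.finished) (rule has_triangle_mono)
next
  case (avoider_move F A)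
  then show ?case
    by (intro enforcer_wins.avoider_move) (auto intro!: avoider_move)
next
  case (enforcer_move v F A)
  then show ?case
    by (blast intro: enforcer_wins.enforcer_move)
qed

text \<open>The rule \<open>finished\<close> asks for an empty board, so a triangle completed early
  is carried to the end by arbitrary moves.\<close>

lemma enforcer_wins_triangle:
  assumes "finite F" "has_triangle E A"
  shows "enforcer_wins E F A t"
  using assms
proof (induction "card F" arbitrary: F A t)
  case 0
  then show ?case by (auto intro: enforcer_wins.finished)
next
  case (Suc n F A t)
  then obtain x where x: "x \<in> F" by (metis card.empty equals0I nat.distinct(1))
  have *: "enforcer_wins E (F - {v}) A' t" if "v \<in> F" "A \<subseteq> A'" for v A' t
    using Suc that by (intro Suc(1)) (auto intro: has_triangle_mono)
  show ?case
  proof (cases t)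
    case True
    then show ?thesis
      using x by (auto intro!: enforcer_wins.avoider_move *)
  next
    case False
    then show ?thesis
      using enforcer_wins.enforcer_move[OF x] *[OF x order_refl] by simp
  qed
qed

text \<open>When Avoider takes a vertex of \<open>R\<close>, Enforcer takes another one, which
  exists by parity. The game on \<open>F\<close> is then unchanged, except that Avoider owns more
  vertices.\<close>

lemma enforcer_wins_absorb_even:
  assumes "enforcer_wins E F A t" "finite R" "even (card R)" "F \<inter> R = {}"
  shows "enforcer_wins E (F \<union> R) A t"
  using assms
proof (induction arbitrary: R rule: enforcer_wins.induct)
  case (finished A t)
  then show ?case by (simp add: enforcer_wins_triangle)
next
  case (avoider_move F A)
  \<comment> \<open>The inner induction on \<open>card R\<close> covers the rounds played in
    \<open>R\<close> before Avoider first moves in \<open>F\<close>; \<open>A'\<close> collects what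
    he gains there.\<close>
  have "enforcer_wins E (F \<union> R) A' True"
    if "finite R" "even (card R)" "F \<inter> R = {}" "A \<subseteq> A'" for R A'
    using that
  proof (induction "card R" arbitrary: R A' rule: less_induct)
    case less
    show ?case
    proof (rule enforcer_wins.avoider_move)
      show "F \<union> R \<noteq> {}" using avoider_move(1) by simp
      fix v assume v: "v \<in> F \<union> R"
      show "enforcer_wins E (F \<union> R - {v}) (insert v A') False"
      proof (cases "v \<in> F")
        case True
        with less.prems have eq: "F \<union> R - {v} = (F - {v}) \<union> R" by blast
        have "enforcer_wins E ((F - {v}) \<union> R) (insert v A) False"
          using True less.prems by (intro avoider_move(3)) auto
        then show ?thesis unfolding eq
          by (rule enforcer_wins_mono) (use less.prems in auto)
      next
        case False
        with v have vR: "v \<in> R" by simp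
        have "R - {v} \<noteq> {}"
        proof
          assume "R - {v} = {}"
          then have "R = {v}" using vR by blast
          then show False using less.prems(2) by simp
        qed
        then obtain w where w: "w \<in> R" "w \<noteq> v" by auto
        have "card (R - {v,w}) = card R - 2"
          using vR w less.prems(1) by (simp add: card_Diff_subset)
        moreover have "card R \<ge> 2"
          using vR w less.prems(1) card_mono[of R "{v,w}"] by simp
        ultimately have "enforcer_wins E (F \<union> (R - {v,w})) (insert v A') True"
          using less.prems by (intro less.hyps) auto
        moreover have "F \<union> R - {v} - {w} = F \<union> (R - {v,w})"
          using less.prems(3) vR w by blast
        ultimately show ?thesis
          using w by (intro enforcer_wins.enforcer_move[of w]) auto
      qed
    qed
  qed
  then show ?case using avoider_move.prems by blast
next
  case (enforcer_move v F A)
  have "F \<union> R - {v} = (F - {v}) \<union> R" using enforcer_move by blast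
  moreover have "enforcer_wins E ((F - {v}) \<union> R) A True"
    using enforcer_move by (intro enforcer_move.IH) auto
  ultimately show ?case
    using enforcer_move(1) by (intro enforcer_wins.enforcer_move[of v]) auto
qed

text \<open>Enforcer always answers in the component in which Avoider has just moved, and Avoider
  completes one of the two winning positions.\<close>

lemma enforcer_wins_union:
  assumes "enforcer_wins E F1 A True" "enforcer_wins E F2 A True"
    and "finite F1" "finite F2" "F1 \<inter> F2 = {}"
  shows "enforcer_wins E (F1 \<union> F2) A True"
  using assms
proof (induction "card F1 + card F2" arbitrary: F1 F2 A rule: less_induct)
  case less
  have key: "enforcer_wins E (X \<union> Y - {v}) (insert v A) False"
    if X: "enforcer_wins E X A True" and Y: "enforcer_wins E Y A True"
      and fin: "finite X" "finite Y" "X \<inter> Y = {}"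
      and c: "card X + card Y = card F1 + card F2" and v: "v \<in> X" for X Y v
  proof -
    have "enforcer_wins E (X - {v}) (insert v A) False"
      using X v by cases auto
    then show ?thesis
    proof cases
      \<comment> \<open>Avoider has taken the last vertex of this component. Enforcer has no answer
        in it, but the triangle is already complete.\<close>
      case finished
      then show ?thesis using fin by (simp add: enforcer_wins_triangle)
    next
      case (enforcer_move w)
      have "card (X - {v} - {w}) < card X"
        using v fin by (intro psubset_card_mono) auto
      with c have "enforcer_wins E ((X - {v} - {w}) \<union> Y) (insert v A) True"
        using enforcer_move fin enforcer_wins_mono[OF Y order_refl subset_insertI]
        by (intro less.hyps) auto
      moreover have "X \<union> Y - {v} - {w} = (X - {v} - {w}) \<union> Y"
        using fin v enforcer_move(1) by blast
      ultimately show ?thesis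
        using enforcer_move(1) by (intro enforcer_wins.enforcer_move[of w]) auto
    qed auto
  qed
  show ?case
  proof (cases "F1 \<union> F2 = {}")
    case True
    then show ?thesis using less by simp
  next
    case False
    have "enforcer_wins E (F1 \<union> F2 - {v}) (insert v A) False" if "v \<in> F1 \<union> F2" for v
      using key[of F1 F2 v] key[of F2 F1 v] less.prems that
      by (auto simp: Un_commute Int_commute add.commute)
    then show ?thesis using False by (intro enforcer_wins.avoider_move)
  qed
qed

text \<open>Transports the win computed on the concrete graph \<open>DD\<close> to its copies.
  Injectivity on the free vertices is what makes removing a vertex commute with taking
  images.\<close>

lemma enforcer_wins_image:
  assumes "enforcer_wins E F A t" "inj_on f F"
  shows "enforcer_wins ((\<lambda>e. f ` e) ` E) (f ` F) (f ` A) t"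
  using assms
proof (induction rule: enforcer_wins.induct)
  case (finished A t)
  then obtain a b c where abc: "a \<in> A" "b \<in> A" "c \<in> A" "{a,b} \<in> E" "{b,c} \<in> E" "{a,c} \<in> E"
    by (auto simp: has_triangle_def)
  have "{f x, f y} \<in> (\<lambda>e. f ` e) ` E" if "{x,y} \<in> E" for x y
    using imageI[OF that, of "\<lambda>e. f ` e"] by simp
  with abc have "has_triangle ((\<lambda>e. f ` e) ` E) (f ` A)"
    unfolding has_triangle_def by (intro bexI[of _ "f a"] bexI[of _ "f b"] bexI[of _ "f c"]) auto
  then show ?case by (auto intro: enforcer_wins.finished)
next
  case (avoider_move F A)
  have "enforcer_wins ((\<lambda>e. f ` e) ` E) (f ` F - {f v}) (insert (f v) (f ` A)) False" if "v \<in> F" for v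
  proof -
    have "f ` F - {f v} = f ` (F - {v})"
      using inj_on_image_set_diff[OF avoider_move.prems, of F "{v}"] that by simp
    then show ?thesis
      using avoider_move.IH[OF that] avoider_move.prems by (simp add: inj_on_diff)
  qed
  then show ?case
    using avoider_move(1) by (auto intro!: enforcer_wins.avoider_move)
next
  case (enforcer_move v F A)
  have "f ` F - {f v} = f ` (F - {v})"
    using inj_on_image_set_diff[OF enforcer_move.prems, of F "{v}"] enforcer_move(1) by simp
  then show ?case
    using enforcer_move by (intro enforcer_wins.enforcer_move[of "f v"]) (auto simp: inj_on_diff)
qed

text \<open>Exhaustive search for Enforcer's win with Avoider to move; the first argument bounds the
  number of rounds and \<open>T\<close> lists the triangles.\<close>

fun enforcer_search :: "nat \<Rightarrow> nat list list \<Rightarrow> nat list \<Rightarrow> nat list \<Rightarrow> bool" where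
  "enforcer_search 0 T F A = list_ex (\<lambda>t. list_all (\<lambda>x. x \<in> set A) t) T"
| "enforcer_search (Suc k) T F A = (list_ex (\<lambda>t. list_all (\<lambda>x. x \<in> set A) t) T \<or>
     (F \<noteq> [] \<and> list_all (\<lambda>v. let F' = remove1 v F in
        F' \<noteq> [] \<and> list_ex (\<lambda>w. enforcer_search k T (remove1 w F') (v # A)) F' \<or>
        list_ex (\<lambda>t. list_all (\<lambda>x. x \<in> set (v # A)) t) T) F))"

lemma enforcer_search_sound:
  assumes T: "\<And>t A. t \<in> set T \<Longrightarrow> set t \<subseteq> A \<Longrightarrow> has_triangle E A"
  shows "enforcer_search k T F A \<Longrightarrow> distinct F \<Longrightarrow> enforcer_wins E (set F) (set A) True"
proof (induction k arbitrary: F A)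
  have tri: "has_triangle E (set A)" if "list_ex (\<lambda>t. list_all (\<lambda>x. x \<in> set A) t) T" for A
    using that T by (fastforce simp: list_ex_iff list_all_iff subset_eq)
  {
    case 0
    then show ?case by (simp add: tri enforcer_wins_triangle)
  next
    case (Suc k)
    show ?case
    proof (cases "list_ex (\<lambda>t. list_all (\<lambda>x. x \<in> set A) t) T")
      case True
      then show ?thesis by (simp add: tri enforcer_wins_triangle)
    next
      case False
      have "enforcer_wins E (set F - {v}) (insert v (set A)) False" if v: "v \<in> set F" for v
      proof -
        let ?F = "remove1 v F"
        have "list_ex (\<lambda>w. enforcer_search k T (remove1 w ?F) (v # A)) ?F
            \<or> list_ex (\<lambda>t. list_all (\<lambda>x. x \<in> set (v # A)) t) T"
          using Suc.prems(1) False v unfolding enforcer_search.simps Let_def list_all_iff[of _ F] by blast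
        then show ?thesis
        proof
          assume "list_ex (\<lambda>w. enforcer_search k T (remove1 w ?F) (v # A)) ?F"
          then obtain w where w: "w \<in> set ?F" "enforcer_search k T (remove1 w ?F) (v # A)"
            by (auto simp: list_ex_iff)
          have "enforcer_wins E (set F - {v} - {w}) (insert v (set A)) True"
            using Suc.IH[OF w(2)] Suc.prems by simp
          then show ?thesis
            using w Suc.prems by (intro enforcer_wins.enforcer_move[of w]) auto
        next
          assume "list_ex (\<lambda>t. list_all (\<lambda>x. x \<in> set (v # A)) t) T"
          then show ?thesis using tri[of "v # A"] by (simp add: enforcer_wins_triangle)
        qed
      qed
      moreover have "F \<noteq> []" using Suc.prems False by simp
      ultimately show ?thesis by (intro enforcer_wins.avoider_move) auto
    qed
  }
qed

lemma enforcer_wins_DD: "enforcer_wins DD {0,1,2,3,4,5,6} {} True"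
proof -
  let ?T = "[[0,1,2],[0,1,3],[0,4,5],[0,4,6]] :: nat list list"
  have T: "has_triangle DD A" if "t \<in> set ?T" "set t \<subseteq> A" for t A
  proof -
    have e: "{0,1} \<in> DD" "{1,2} \<in> DD" "{0,2} \<in> DD" "{1,3} \<in> DD" "{0,3} \<in> DD"
      "{0,4} \<in> DD" "{4,5} \<in> DD" "{0,5} \<in> DD" "{4,6} \<in> DD" "{0,6} \<in> DD"
      by (simp_all add: DD_def)
    have "\<exists>a b c. t = [a,b,c] \<and> {a,b} \<in> DD \<and> {b,c} \<in> DD \<and> {a,c} \<in> DD"
      using that(1) e by auto
    then show ?thesis using that(2) unfolding has_triangle_def by fastforce
  qed
  \<comment> \<open>Avoider makes four of the seven moves, hence depth 4. The list puts the tips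
    before the spine vertices, so the first replies tried leave the vertices of high degree to
    Avoider.\<close>
  have "enforcer_search 4 ?T [2,5,3,6,1,4,0] []"
    by code_simp
  from enforcer_search_sound[OF T this] show ?thesis by (simp add: insert_commute)
qed

section \<open>Pairing strategies for Avoider\<close>

definition matching_in :: "nat set set \<Rightarrow> nat set \<Rightarrow> bool" where
  "matching_in Q F \<longleftrightarrow> (\<forall>q\<in>Q. q \<subseteq> F \<and> card q = 2) \<and> pairwise disjnt Q"

text \<open>\<open>V\<close> is meant as the set of vertices not taken by Enforcer: triangles
  through one of his vertices are dead and need not be hit.\<close>

definition hits_triangles :: "nat set set \<Rightarrow> nat set set \<Rightarrow> nat set \<Rightarrow> bool" where
  "hits_triangles E Q V \<longleftrightarrow> (\<forall>a\<in>V. \<forall>b\<in>V. \<forall>c\<in>V.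
     {a,b} \<in> E \<and> {b,c} \<in> E \<and> {a,c} \<in> E \<longrightarrow> (\<exists>q\<in>Q. q \<subseteq> {a,b,c}))"

lemma hits_triangles_empty: "hits_triangles E {} A \<Longrightarrow> \<not> has_triangle E A"
  unfolding hits_triangles_def has_triangle_def by blast

lemma matching_in_empty: "matching_in Q {} \<Longrightarrow> Q = {}"
  unfolding matching_in_def by force

lemma matching_in_Un:
  assumes "matching_in Q F" "matching_in R G" "F \<inter> G = {}"
  shows "matching_in (Q \<union> R) (F \<union> G)"
proof -
  have "disjnt p q" if "p \<in> Q" "q \<in> R" for p q
    using assms that unfolding matching_in_def disjnt_def by blast
  then show ?thesis
    using assms unfolding matching_in_def pairwise_def by (auto simp: disjnt_sym)
qed

lemma even_card_matching:
  assumes "finite F" "matching_in Q F"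
  shows "even (card (\<Union>Q))"
proof -
  have "finite q" if "q \<in> Q" for q
    using assms that finite_subset unfolding matching_in_def by blast
  then have "card (\<Union>Q) = sum card Q"
    using assms by (intro card_Union_disjoint) (auto simp: matching_in_def)
  also have "\<dots> = 2 * card Q"
    using assms by (simp add: matching_in_def)
  finally show ?thesis by simp
qed

lemma unmatched_vertex:
  assumes "finite F" "odd (card F)" "matching_in Q F"
  shows "\<exists>v\<in>F. \<forall>q\<in>Q. v \<notin> q"
proof -
  have "\<Union>Q \<subseteq> F" using assms by (auto simp: matching_in_def)
  moreover have "\<Union>Q \<noteq> F" using even_card_matching[of F Q] assms by auto
  ultimately show ?thesis by blast
qed

text \<open>One condition covers both kinds of reply: \<open>v\<close> is the partner of
  \<open>u\<close>, or both are unmatched. In the second case an unmatched \<open>v\<close> exists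
  because an odd number of vertices is left.\<close>

lemma avoider_reply:
  assumes "finite F" "even (card F)" "matching_in Q F" "u \<in> F"
  shows "\<exists>v\<in>F - {u}. \<forall>q\<in>Q. v \<in> q \<longrightarrow> u \<in> q"
proof (cases "u \<in> \<Union>Q")
  case True
  then obtain q where q: "q \<in> Q" "u \<in> q" by blast
  then have "card q = 2" "q \<subseteq> F" using assms by (auto simp: matching_in_def)
  then obtain v where v: "q = {u,v}" "v \<noteq> u"
    using q by (auto simp: card_2_iff)
  have "u \<in> r" if "r \<in> Q" "v \<in> r" for r
  proof (rule ccontr)
    assume "u \<notin> r"
    then have "disjnt r q" using assms(3) that q by (auto simp: matching_in_def pairwise_def)
    then show False using that v by (auto simp: disjnt_def)
  qed
  then show ?thesis using v \<open>q \<subseteq> F\<close> by blast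
next
  case False
  have "odd (card (F - {u}))" using assms card.remove[of F u] by (metis even_Suc)
  moreover have "matching_in Q (F - {u})"
    using assms(3) False by (auto simp: matching_in_def)
  ultimately show ?thesis
    using unmatched_vertex[of "F - {u}" Q] assms(1) by blast
qed

lemma matching_in_remove:
  assumes "matching_in Q F" "\<forall>q\<in>Q. v \<in> q \<longrightarrow> u \<in> q"
  shows "matching_in {q\<in>Q. u \<notin> q} (F - {u} - {v})"
  using assms unfolding matching_in_def pairwise_def by auto

lemma card_remove2:
  assumes "finite F" "u \<in> F" "v \<in> F" "u \<noteq> v"
  shows "card F = Suc (Suc (card (F - {u} - {v})))"
  using assms card.remove[of F u] card.remove[of "F - {u}" v] by (metis Diff_iff finite_Diff singletonD)

text \<open>Avoider takes the partner of Enforcer's vertex if it has one and an unmatched vertex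
  otherwise.\<close>

lemma avoider_wins_last:
  assumes "finite F" "even (card F)" "matching_in Q F" "hits_triangles E Q (F \<union> A)" "F \<inter> A = {}"
  shows "\<not> enforcer_wins E F A False"
  using assms
proof (induction "card F" arbitrary: F A Q rule: less_induct)
  case less
  show ?case
  proof
    assume "enforcer_wins E F A False"
    then show False
    proof cases
      case finished
      then show False
        using less.prems hits_triangles_empty matching_in_empty by (metis Un_empty_left)
    next
      case (enforcer_move u)
      obtain v where v: "v \<in> F - {u}" "\<forall>q\<in>Q. v \<in> q \<longrightarrow> u \<in> q"
        using avoider_reply less.prems enforcer_move by metis
      from enforcer_move(2) have "enforcer_wins E (F - {u} - {v}) (insert v A) False"
        using v by cases auto
      \<comment> \<open>The pair given up contains \<open>u\<close>, which now belongs to Enforcer,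
        so no triangle that is still alive relies on it.\<close>
      moreover have "hits_triangles E {q\<in>Q. u \<notin> q} ((F - {u} - {v}) \<union> insert v A)"
        unfolding hits_triangles_def
      proof (intro ballI impI)
        fix a b c assume *: "a \<in> F - {u} - {v} \<union> insert v A" "b \<in> F - {u} - {v} \<union> insert v A"
          "c \<in> F - {u} - {v} \<union> insert v A" "{a,b} \<in> E \<and> {b,c} \<in> E \<and> {a,c} \<in> E"
        then obtain q where "q \<in> Q" "q \<subseteq> {a,b,c}"
          using less.prems(4) v unfolding hits_triangles_def by (metis DiffD1 UnCI UnE insertE)
        moreover have "u \<notin> {a,b,c}"
          using * v less.prems(5) enforcer_move(1) by auto
        ultimately show "\<exists>q\<in>{q\<in>Q. u \<notin> q}. q \<subseteq> {a,b,c}" by blast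
      qed
      ultimately show False
        using less.hyps[of "F - {u} - {v}" "{q\<in>Q. u \<notin> q}" "insert v A"] less.prems v
          matching_in_remove[OF less.prems(3) v(2)] card_remove2[of F u v] enforcer_move(1)
        by auto
    qed auto
  qed
qed

text \<open>Avoider keeps an odd set \<open>D\<close> in reserve, with the property that as soon as Enforcer takes a
  vertex of \<open>D\<close>, a matching hits all the remaining triangles. Either Enforcer opens \<open>D\<close>, and then
  Avoider can continue with a reserve of size one, or nothing but \<open>D\<close> is left.\<close>

lemma avoider_wins_reserve:
  assumes "finite F" "D \<subseteq> F" "odd (card D)" "even (card (F - D))" "matching_in Q (F - D)"
    and "\<And>u. u \<in> D \<Longrightarrow> \<exists>R. matching_in R (D - {u}) \<and> hits_triangles E (Q \<union> R) (F - {u} \<union> A)"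
    and "F \<inter> A = {}"
  shows "\<not> enforcer_wins E F A False"
  using assms
proof (induction "card F" arbitrary: F A D Q rule: less_induct)
  case less
  show ?case
  proof
    assume "enforcer_wins E F A False"
    then show False
    proof cases
      case finished
      \<comment> \<open>An odd \<open>D\<close> is not empty, so play cannot end before Enforcer has
        opened it.\<close>
      then show False using less.prems(2,3) by auto
    next
      case (enforcer_move u)
      show False
      proof (cases "u \<in> D")
        case False
        obtain v where v: "v \<in> F - D - {u}" "\<forall>q\<in>Q. v \<in> q \<longrightarrow> u \<in> q"
          using avoider_reply[of "F - D" Q u] less.prems enforcer_move False by auto
        from enforcer_move(2) have w: "enforcer_wins E (F - {u} - {v}) (insert v A) False"
          using v by cases auto
        have "\<exists>R. matching_in R (D - {x}) \<and>
           hits_triangles E ({q\<in>Q. u \<notin> q} \<union> R) (F - {u} - {v} - {x} \<union> insert v A)" if x: "x \<in> D" for x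
        proof -
          obtain R where R: "matching_in R (D - {x})" "hits_triangles E (Q \<union> R) (F - {x} \<union> A)"
            using less.prems(6)[OF x] by blast
          have "hits_triangles E ({q\<in>Q. u \<notin> q} \<union> R) (F - {u} - {v} - {x} \<union> insert v A)"
            unfolding hits_triangles_def
          proof (intro ballI impI)
            let ?V = "F - {u} - {v} - {x} \<union> insert v A"
            fix a b c assume *: "a \<in> ?V" "b \<in> ?V" "c \<in> ?V" "{a,b} \<in> E \<and> {b,c} \<in> E \<and> {a,c} \<in> E"
            have "?V \<subseteq> F - {x} \<union> A" using v x by auto
            then obtain q where "q \<in> Q \<union> R" "q \<subseteq> {a,b,c}"
              using R(2) * unfolding hits_triangles_def by (meson subsetD)
            moreover have "u \<notin> {a,b,c}"
              using * v less.prems(7) enforcer_move(1) by auto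
            ultimately show "\<exists>q\<in>{q\<in>Q. u \<notin> q} \<union> R. q \<subseteq> {a,b,c}" by blast
          qed
          with R show ?thesis by blast
        qed
        moreover have "F - {u} - {v} - D = F - D - {u} - {v}" by blast
        moreover have "matching_in {q\<in>Q. u \<notin> q} (F - D - {u} - {v})"
          using matching_in_remove[OF less.prems(5) v(2)] .
        moreover have "card F = Suc (Suc (card (F - {u} - {v})))"
          using card_remove2[of F u v] less.prems v enforcer_move(1) by simp
        moreover have "card (F - D) = Suc (Suc (card (F - D - {u} - {v})))"
          using card_remove2[of "F - D" u v] less.prems v enforcer_move(1) False by simp
        ultimately have "\<not> enforcer_wins E (F - {u} - {v}) (insert v A) False"
          using less.prems(1-4,7) v False
          by (intro less.hyps[of "F - {u} - {v}" D "{q\<in>Q. u \<notin> q}" "insert v A"]) auto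
        with w show False by blast
      next
        case True
        let ?F = "F - {u}"
        obtain R where R: "matching_in R (D - {u})" "hits_triangles E (Q \<union> R) (?F \<union> A)"
          using less.prems(6)[OF True] by blast
        have "?F = (F - D) \<union> (D - {u})" using True less.prems by blast
        then have M: "matching_in (Q \<union> R) ?F"
          using matching_in_Un[OF less.prems(5) R(1)] by auto
        have "card F = card (F - D) + card D"
          using less.prems card_mono[of F D] by (simp add: card_Diff_subset finite_subset)
        then have oddF: "odd (card F)" using less.prems by simp
        then have evenF: "even (card ?F)"
          using True less.prems enforcer_move(1) by (simp)
        show False
        proof (cases "?F = {}")
          case True
          with enforcer_move(2) have "has_triangle E A" by cases auto
          with True M R show False
            using hits_triangles_empty matching_in_empty by (metis Un_empty_left)
        next
          case False
          \<comment> \<open>Enforcer has opened the reserve, and Avoider has to move with an even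
            number of free vertices and a matching on them. He takes \<open>v\<close> and makes its
            partner \<open>d\<close> the new reserve (or both are unmatched): once Enforcer takes
            \<open>d\<close>, the broken pair does no harm.\<close>
          then obtain d where d: "d \<in> ?F" by blast
          obtain v where v: "v \<in> ?F - {d}" "\<forall>q\<in>Q \<union> R. v \<in> q \<longrightarrow> d \<in> q"
            using avoider_reply[OF _ evenF M d] less.prems by auto
          from enforcer_move(2) have w: "enforcer_wins E (?F - {v}) (insert v A) False"
            using v by cases auto
          have eq: "?F - {v} - {d} = ?F - {d} - {v}" by blast
          have m: "matching_in {q\<in>Q \<union> R. d \<notin> q} (?F - {v} - {d})"
            unfolding eq by (rule matching_in_remove[OF M v(2)])
          have "hits_triangles E {q\<in>Q \<union> R. d \<notin> q} (?F - {v} - {d} \<union> insert v A)"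
            unfolding hits_triangles_def
          proof (intro ballI impI)
            let ?V = "?F - {v} - {d} \<union> insert v A"
            fix a b c assume *: "a \<in> ?V" "b \<in> ?V" "c \<in> ?V" "{a,b} \<in> E \<and> {b,c} \<in> E \<and> {a,c} \<in> E"
            have "?V \<subseteq> ?F \<union> A" using v by auto
            then obtain q where "q \<in> Q \<union> R" "q \<subseteq> {a,b,c}"
              using R(2) * unfolding hits_triangles_def by (meson subsetD)
            moreover have "d \<notin> {a,b,c}"
              using * v d less.prems(7) by auto
            ultimately show "\<exists>q\<in>{q\<in>Q \<union> R. d \<notin> q}. q \<subseteq> {a,b,c}" by blast
          qed
          then have h: "\<exists>S. matching_in S ({d} - {x}) \<and>
              hits_triangles E ({q\<in>Q \<union> R. d \<notin> q} \<union> S) (?F - {v} - {x} \<union> insert v A)" if "x \<in> {d}" for x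
            using that by (intro exI[of _ "{}"]) (auto simp: matching_in_def)
          have c2: "card ?F = Suc (Suc (card (?F - {v} - {d})))"
            using card_remove2[of ?F v d] less.prems v d by simp
          have c3: "card (?F - {v}) < card F"
            using less.prems v enforcer_move(1) by (intro psubset_card_mono) auto
          have "\<not> enforcer_wins E (?F - {v}) (insert v A) False"
            using less.prems(1,7) v d m c2 evenF
            by (intro less.hyps[OF c3, of "{d}" "{q\<in>Q \<union> R. d \<notin> q}" "insert v A"] h) auto
          with w show False by blast
        qed
      qed
    qed auto
  qed
qed

lemma hits_triangles_mono:
  "hits_triangles E Q V \<Longrightarrow> U \<subseteq> V \<Longrightarrow> hits_triangles E Q U"
  unfolding hits_triangles_def by blast

text \<open>The turn \<open>even (card V)\<close> means that Enforcer moves last. If he also moves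
  first, the reserve strategy starts at once. Otherwise \<open>V - D\<close> is odd, and Avoider
  opens with an unmatched vertex outside \<open>D\<close>, which breaks no pair.\<close>

lemma avoider_wins_reserve_start:
  assumes "finite V" "D \<subseteq> V" "odd (card D)" "matching_in Q (V - D)"
    and "\<And>u. u \<in> D \<Longrightarrow> \<exists>R. matching_in R (D - {u}) \<and> hits_triangles E (Q \<union> R) (V - {u})"
  shows "\<not> enforcer_wins E V {} (even (card V))"
proof (cases "even (card V)")
  case False
  have "even (card (V - D))"
    using assms False card_mono[of V D] by (simp add: card_Diff_subset finite_subset)
  with False show ?thesis
    using avoider_wins_reserve[of V D Q E "{}"] assms by simp
next
  case True
  have "odd (card (V - D))"
    using assms True card_mono[of V D] by (simp add: card_Diff_subset finite_subset)
  then obtain v where v: "v \<in> V - D" "\<forall>q\<in>Q. v \<notin> q"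
    using unmatched_vertex[of "V - D" Q] assms(1,4) by blast
  have m: "matching_in Q (V - {v} - D)"
    using assms(4) v by (auto simp: matching_in_def)
  have "card (V - {v} - D) = card (V - D) - 1"
    using v assms by (metis Diff_insert Diff_insert2 card_Diff_singleton)
  then have ev: "even (card (V - {v} - D))" using \<open>odd (card (V - D))\<close> by simp
  have h: "\<exists>R. matching_in R (D - {u}) \<and> hits_triangles E (Q \<union> R) (V - {v} - {u} \<union> {v})" if "u \<in> D" for u
    using assms(5)[OF that] hits_triangles_mono[of E _ "V - {u}" "V - {v} - {u} \<union> {v}"] v that by blast
  have "\<not> enforcer_wins E (V - {v}) {v} False"
    using assms(1-3) m ev v by (intro avoider_wins_reserve[of "V - {v}" D Q E "{v}"] h) auto
  then have "\<not> enforcer_wins E V {} True"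
    using v by (auto elim: enforcer_wins.cases)
  then show ?thesis using True by simp
qed

text \<open>If Avoider moves last, he answers within pairs, after opening with an unmatched vertex
  if he also moves first. If Enforcer moves last, a single vertex \<open>d\<close> is the reserve:
  triangles through \<open>d\<close> die when Enforcer takes it, so the pair of \<open>d\<close> may
  be dropped.\<close>

lemma avoider_wins_matching:
  assumes "finite V" "matching_in Q V" "hits_triangles E Q V"
  shows "\<not> enforcer_wins E V {} t"
proof (cases "t = even (card V)")
  case False
  show ?thesis
  proof (cases "even (card V)")
    case True
    then show ?thesis using avoider_wins_last[of V Q E "{}"] assms False by simp
  next
    case odd: False
    then obtain v where v: "v \<in> V" "\<forall>q\<in>Q. v \<notin> q"
      using unmatched_vertex[of V Q] assms(1,2) by blast
    have "matching_in Q (V - {v})"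
      using assms v by (auto simp: matching_in_def)
    then have "\<not> enforcer_wins E (V - {v}) {v} False"
      using avoider_wins_last[of "V - {v}" Q E "{v}"] assms odd v by (simp add: insert_absorb)
    with odd False show ?thesis
      using v by (auto elim: enforcer_wins.cases)
  qed
next
  case True
  show ?thesis
  proof (cases "V = {}")
    case True
    then show ?thesis
      using assms hits_triangles_empty matching_in_empty
      by (metis enforcer_wins.cases empty_iff)
  next
    case ne: False
    obtain d where d: "d \<in> V" "\<exists>Q'. matching_in Q' (V - {d}) \<and> hits_triangles E Q' (V - {d})"
    proof (cases "even (card V)")
      case True
      obtain d where d: "d \<in> V" using ne by blast
      have "matching_in {q\<in>Q. d \<notin> q} (V - {d})"
        using matching_in_remove[OF assms(2), of d d] by (auto simp: matching_in_def)
      moreover have "hits_triangles E {q\<in>Q. d \<notin> q} (V - {d})"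
        using assms(3) unfolding hits_triangles_def by blast
      ultimately show ?thesis using d that by blast
    next
      case False
      then obtain d where d: "d \<in> V" "\<forall>q\<in>Q. d \<notin> q"
        using unmatched_vertex[of V Q] assms(1,2) by blast
      then show ?thesis
        using that[of d] assms hits_triangles_mono[of E Q V "V - {d}"] by (auto simp: matching_in_def)
    qed
    then obtain Q' where "matching_in Q' (V - {d})" "hits_triangles E Q' (V - {d})" by blast
    then show ?thesis
      unfolding True
      using d(1) assms by (intro avoider_wins_reserve_start[of V "{d}" Q'])
        (auto intro!: exI[of _ "{}"] simp: matching_in_def)
  qed
qed


section \<open>Triangles in locally sparse graphs\<close>

definition edges_in :: "nat set set \<Rightarrow> nat set \<Rightarrow> nat set set" where
  "edges_in E S = {e \<in> E. e \<subseteq> S}"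

text \<open>The weights 10 and 7 are the numbers of edges and vertices of the double diamond, which therefore
  has excess 0.\<close>

definition excess :: "nat set set \<Rightarrow> nat set \<Rightarrow> int" where
  "excess E S = 10 * int (card S) - 7 * int (card (edges_in E S))"

text \<open>The bound 30 leaves room above the sizes that occur: clusters have at most 21 vertices,
  and at most four more are added to refute a configuration.\<close>

definition locally_sparse :: "nat set set \<Rightarrow> bool" where
  "locally_sparse E \<longleftrightarrow> (\<forall>S. finite S \<and> card S \<le> 30 \<longrightarrow> 0 \<le> excess E S)"

lemma finite_edges_in: "finite S \<Longrightarrow> finite (edges_in E S)"
  unfolding edges_in_def by (rule finite_subset[of _ "Pow S"]) auto

lemma excess_extend:
  assumes "finite S'" "S \<subseteq> S'" "N \<subseteq> edges_in E S'" "\<And>e. e \<in> N \<Longrightarrow> \<not> e \<subseteq> S"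
    and "card S' \<le> card S + k"
  shows "excess E S' \<le> excess E S + 10 * int k - 7 * int (card N)"
proof -
  have "finite (edges_in E S')" "finite S" using assms finite_edges_in finite_subset by auto
  then have fin: "finite (edges_in E S)" "finite N" "edges_in E S \<inter> N = {}"
    using assms finite_subset[OF assms(3)] finite_edges_in by (auto simp: edges_in_def)
  have "edges_in E S \<union> N \<subseteq> edges_in E S'" using assms by (auto simp: edges_in_def)
  then have "card (edges_in E S \<union> N) \<le> card (edges_in E S')"
    using \<open>finite (edges_in E S')\<close> by (rule card_mono[rotated])
  then have "card (edges_in E S) + card N \<le> card (edges_in E S')"
    using card_Un_disjoint[OF fin] by simp
  then show ?thesis unfolding excess_def using assms(5) by linarith
qed

lemma excess_le:
  assumes "finite S" "N \<subseteq> edges_in E S" "card S \<le> k" "{} \<notin> N"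
  shows "excess E S \<le> 10 * int k - 7 * int (card N)"
proof -
  have "\<not> e \<subseteq> {}" if "e \<in> N" for e using that assms(4) by auto
  then show ?thesis
    using excess_extend[of S "{}" N E k] assms(1-3) by (auto simp: excess_def)
qed

locale sparse_graph =
  fixes E :: "nat set set"
  assumes locally_sparse: "locally_sparse E" and card_edge: "\<And>e. e \<in> E \<Longrightarrow> card e = 2"
begin

abbreviation tri :: "nat \<Rightarrow> nat \<Rightarrow> nat \<Rightarrow> bool" where
  "tri a b c \<equiv> {a,b} \<in> E \<and> {b,c} \<in> E \<and> {a,c} \<in> E"

text \<open>\<open>x\<close> and \<open>y\<close> form the spine, \<open>z\<close> and
  \<open>w\<close> are the tips. The other inequalities follow from \<open>edge_neq\<close>.\<close>

definition diamond :: "nat \<Rightarrow> nat \<Rightarrow> nat \<Rightarrow> nat \<Rightarrow> bool" where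
  "diamond x y z w \<longleftrightarrow> tri x y z \<and> tri x y w \<and> z \<noteq> w"

text \<open>Tightness excludes triangles of \<open>V\<close> that share exactly an edge with
  \<open>S\<close>; closedness also excludes those that share a single vertex. Growth preserves the
  former and aims at the latter, since a closed set can be split off.\<close>

definition triangle_tight :: "nat set \<Rightarrow> nat set \<Rightarrow> bool" where
  "triangle_tight V S \<longleftrightarrow> (\<forall>a\<in>S. \<forall>b\<in>S. \<forall>c\<in>V. tri a b c \<longrightarrow> c \<in> S)"

definition triangle_closed :: "nat set \<Rightarrow> nat set \<Rightarrow> bool" where
  "triangle_closed V S \<longleftrightarrow> (\<forall>a\<in>S. \<forall>b\<in>V. \<forall>c\<in>V. tri a b c \<longrightarrow> b \<in> S \<and> c \<in> S)"

definition matched :: "nat set \<Rightarrow> bool" where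
  "matched S \<longleftrightarrow> (\<exists>Q. matching_in Q S \<and> hits_triangles E Q S)"

definition has_DD :: "nat set \<Rightarrow> bool" where
  "has_DD V \<longleftrightarrow> (\<exists>x y z w y' z' w'. {x,y,z,w,y',z',w'} \<subseteq> V \<and> distinct [x,y,z,w,y',z',w'] \<and>
     diamond x y z w \<and> diamond x y' z' w')"

lemma has_DDI:
  assumes "{x,y,z,w,y',z',w'} \<subseteq> V" "distinct [x,y,z,w,y',z',w']" "diamond x y z w" "diamond x y' z' w'"
  shows "has_DD V"
  unfolding has_DD_def using assms by (intro exI conjI)

lemma edge_neq: "{a,b} \<in> E \<Longrightarrow> a \<noteq> b"
  using card_edge[of "{a,b}"] by auto

lemma edge_sym: "{a,b} \<in> E \<longleftrightarrow> {b,a} \<in> E"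
  by (simp add: insert_commute)

lemma excess_nonneg: "finite S \<Longrightarrow> card S \<le> 30 \<Longrightarrow> 0 \<le> excess E S"
  using locally_sparse by (simp add: locally_sparse_def)

lemma diamond_neq:
  assumes "diamond x y z w"
  shows "x \<noteq> y" "x \<noteq> z" "x \<noteq> w" "y \<noteq> z" "y \<noteq> w" "z \<noteq> w"
  using assms edge_neq unfolding diamond_def by blast+

lemma diamond_sym: "diamond x y z w \<Longrightarrow> diamond y x z w" "diamond x y z w \<Longrightarrow> diamond x y w z"
  using edge_sym unfolding diamond_def by blast+

text \<open>One new vertex with two new edges: 10 - 14.\<close>

lemma excess_two_edges:
  assumes "finite S" "a \<in> S" "b \<in> S" "c \<notin> S" "tri a b c"
  shows "excess E (insert c S) \<le> excess E S - 4"
proof -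
  have "a \<noteq> b" "a \<noteq> c" "b \<noteq> c" using assms edge_neq by blast+
  then have "card {{a,c},{b,c}} = 2" by (auto simp: doubleton_eq_iff)
  then show ?thesis
    using excess_extend[of "insert c S" S "{{a,c},{b,c}}" E 1] assms
    by (auto simp: edges_in_def)
qed

text \<open>Two new vertices with three new edges: 20 - 21.\<close>

lemma excess_triangle_at_vertex:
  assumes "finite S" "v \<in> S" "a \<notin> S" "b \<notin> S" "tri v a b"
  shows "excess E (insert a (insert b S)) \<le> excess E S - 1"
proof -
  have "a \<noteq> b" "v \<noteq> a" "v \<noteq> b" using assms edge_neq by blast+
  then have "card {{v,a},{a,b},{v,b}} = 3" "card (insert a (insert b S)) \<le> card S + 2"
    using assms by (auto simp: doubleton_eq_iff)
  then show ?thesis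
    using excess_extend[of "insert a (insert b S)" S "{{v,a},{a,b},{v,b}}" E 2] assms
    by (auto simp: edges_in_def)
qed

text \<open>Three new vertices and, since an edge needs two vertices, five new edges: 30 -
  35.\<close>

lemma excess_diamond_at_vertex:
  assumes "finite S" "diamond x y z w" "card ({x,y,z,w} \<inter> S) = 1"
  shows "excess E (S \<union> {x,y,z,w}) \<le> excess E S - 5"
proof -
  note neq = diamond_neq[OF assms(2)]
  let ?D = "{x,y,z,w}" and ?N = "{{x,y},{x,z},{x,w},{y,z},{y,w}}"
  have "card ?N = 5" using neq by (auto simp: doubleton_eq_iff)
  have "card (S \<union> ?D) + card (?D \<inter> S) = card S + card ?D"
    using card_Un_Int[of S ?D] assms(1) by (simp add: Int_commute)
  moreover have "card ?D = 4" using neq by simp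
  ultimately have c: "card (S \<union> ?D) \<le> card S + 3" using assms(3) by simp
  have "\<not> e \<subseteq> S" if "e \<in> ?N" for e
  proof
    assume "e \<subseteq> S"
    then have "e \<subseteq> ?D \<inter> S" using that by auto
    moreover have "card e = 2" using that neq by auto
    ultimately have "2 \<le> card (?D \<inter> S)"
      by (metis card_mono finite.emptyI finite_Int finite_insert)
    then show False using assms(3) by simp
  qed
  then show ?thesis
    using excess_extend[of "S \<union> ?D" S ?N E 3] assms(1,2) c \<open>card ?N = 5\<close>
    by (auto simp: edges_in_def diamond_def)
qed

section \<open>Growing clusters of triangles together with a matching\<close>

lemma triangle_tight_small_excess:
  assumes "finite S" "card S < 30" "excess E S \<le> 3"
  shows "triangle_tight V S"
  unfolding triangle_tight_def
proof (intro ballI impI)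
  fix a b c assume *: "a \<in> S" "b \<in> S" "c \<in> V" "tri a b c"
  show "c \<in> S"
  proof (rule ccontr)
    assume "c \<notin> S"
    then have "excess E (insert c S) \<le> excess E S - 4" "card (insert c S) \<le> 30"
      using excess_two_edges[OF assms(1)] * assms(1,2) by auto
    then show False using excess_nonneg[of "insert c S"] assms by simp
  qed
qed

text \<open>By tightness a triangle that leaves \<open>S\<close> has at least two vertices outside,
  that is both \<open>a\<close> and \<open>b\<close>, so the pair of \<open>a\<close> and
  \<open>b\<close> takes care of all new triangles.\<close>

lemma matched_insert_triangle:
  assumes "triangle_tight V S" "matched S" "a \<in> V - S" "b \<in> V - S" "a \<noteq> b"
  shows "matched (insert a (insert b S))"
proof -
  obtain Q where Q: "matching_in Q S" "hits_triangles E Q S"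
    using assms(2) by (auto simp: matched_def)
  let ?Q = "Q \<union> {{a,b}}" and ?S = "insert a (insert b S)"
  have "matching_in {{a,b}} {a,b}" using assms by (auto simp: matching_in_def)
  moreover have "?S = S \<union> {a,b}" by blast
  ultimately have m: "matching_in ?Q ?S"
    using matching_in_Un[OF Q(1), of "{{a,b}}" "{a,b}"] assms by auto
  have "hits_triangles E ?Q ?S"
    unfolding hits_triangles_def
  proof (intro ballI impI)
    fix p q r assume *: "p \<in> ?S" "q \<in> ?S" "r \<in> ?S" "tri p q r"
    have **: "tri q r p" "tri p r q" using * edge_sym by blast+
    have "p \<noteq> q" "p \<noteq> r" "q \<noteq> r" using * edge_neq by blast+
    show "\<exists>q'\<in>?Q. q' \<subseteq> {p,q,r}"
    proof (cases "p \<in> S \<and> q \<in> S \<and> r \<in> S")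
      case True
      then show ?thesis using Q(2) * unfolding hits_triangles_def by (meson UnI1)
    next
      case False
      have no: "c \<in> S" if "x \<in> S" "y \<in> S" "c \<in> ?S" "tri x y c" for x y c
        using that assms(1,3,4) unfolding triangle_tight_def by blast
      have "(p \<notin> S \<and> q \<notin> S) \<or> (q \<notin> S \<and> r \<notin> S) \<or> (p \<notin> S \<and> r \<notin> S)"
        using False no[of p q r] no[of q r p] no[of p r q] * ** by argo
      then have "{a,b} \<subseteq> {p,q,r}"
        using *(1-3) \<open>p \<noteq> q\<close> \<open>p \<noteq> r\<close> \<open>q \<noteq> r\<close> by auto
      then show ?thesis by blast
    qed
  qed
  with m show ?thesis by (auto simp: matched_def)
qed

text \<open>Triangles meeting \<open>S\<close> in a single vertex are added one by one, each together with the
  matching edge formed by its two new vertices. The bound on \<open>card S + 2 * excess E S\<close> is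
  preserved and keeps all sets in the range of sparseness.\<close>

lemma grow_closed:
  assumes "finite V" "S \<subseteq> V" "matched S" "triangle_tight V S"
    and "0 \<le> excess E S" "excess E S \<le> 9" "int (card S) + 2 * excess E S \<le> 21"
    and "excess E S \<le> 4 \<or> (\<forall>x y z w. diamond x y z w \<longrightarrow> {x,y,z,w} \<subseteq> V \<longrightarrow> card ({x,y,z,w} \<inter> S) \<noteq> 1)"
    and "excess E S \<le> 5 \<or> (\<forall>x y z w. diamond x y z w \<longrightarrow> \<not> {x,y,z,w} \<subseteq> V)"
  shows "\<exists>S'. S \<subseteq> S' \<and> S' \<subseteq> V \<and> matched S' \<and> triangle_closed V S'"
  using assms
proof (induction "nat (excess E S)" arbitrary: S rule: less_induct)
  case less
  note tight = less.prems(4)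
  have finS: "finite S" using finite_subset[OF less.prems(2,1)] .
  show ?case
  proof (cases "triangle_closed V S")
    case True
    then show ?thesis using less.prems(2,3) by blast
  next
    case False
    then obtain v a b where v: "v \<in> S" "a \<in> V" "b \<in> V" "tri v a b" "\<not> (a \<in> S \<and> b \<in> S)"
      by (auto simp: triangle_closed_def)
    have neq: "v \<noteq> a" "v \<noteq> b" "a \<noteq> b" using v edge_neq by blast+
    have "tri v b a" using v edge_sym by blast
    then have ab: "a \<notin> S" "b \<notin> S"
      using v tight unfolding triangle_tight_def by blast+
    \<comment> \<open>The step adds two vertices and costs at least 1. The constant 21 is 3 + 2 * 9,
      the value at a single triangle.\<close>
    let ?S = "insert a (insert b S)"
    have finS': "finite ?S" using finS by simp
    have cS': "card ?S = card S + 2" using ab neq finS by simp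
    have ex: "excess E ?S \<le> excess E S - 1"
      using excess_triangle_at_vertex[OF finS] v ab by blast
    have "0 \<le> excess E ?S"
      using cS' less.prems(5,7) finS' by (intro excess_nonneg) auto
    \<comment> \<open>Such a diamond costs 5, while the hypotheses leave a budget of at most 4
      whenever one is present.\<close>
    have no_dia: False if "diamond x y z w" "{x,y,z,w} \<subseteq> V" "card ({x,y,z,w} \<inter> S) = 1" for x y z w
    proof -
      have "excess E S \<le> 4" using less.prems(8) that by blast
      moreover have "excess E (S \<union> {x,y,z,w}) \<le> excess E S - 5"
        using excess_diamond_at_vertex[OF finS] that by blast
      moreover have "card (S \<union> {x,y,z,w}) \<le> 30"
      proof -
        have "card (S \<union> {x,y,z,w}) \<le> card S + card {x,y,z,w}" by (rule card_Un_le)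
        moreover have "card {x,y,z,w} \<le> 4" by (simp add: card_insert_if)
        ultimately show ?thesis using less.prems(5,7) by linarith
      qed
      ultimately show False using excess_nonneg[of "S \<union> {x,y,z,w}"] finS by simp
    qed
    have tight': "triangle_tight V ?S"
      unfolding triangle_tight_def
    proof (intro ballI impI)
      fix p q r assume *: "p \<in> ?S" "q \<in> ?S" "r \<in> V" "tri p q r"
      show "r \<in> ?S"
      proof (rule ccontr)
        assume r: "r \<notin> ?S"
        \<comment> \<open>The offending triangle has one old vertex \<open>s\<close> and one new
          vertex \<open>c\<close>. If \<open>s\<close> is the attachment vertex \<open>v\<close>, it
          forms a diamond with the triangle just added. Otherwise three vertices and six edges are
          new at a cost of 12, more than the available 9.\<close>
        have one: False if sc: "s \<in> S" "c = a \<or> c = b" "tri s c r" for s c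
        proof (cases "s = v")
          case True
          obtain d where d: "tri v c d" "d = a \<or> d = b"
            using sc(2) v(4) \<open>tri v b a\<close> by blast
          have dia: "diamond v c d r"
            using sc(3) d r True unfolding diamond_def by auto
          have "{v,c,d,r} \<inter> S = {v}"
            using sc(2) d(2) v(1) ab r by auto
          then have "card ({v,c,d,r} \<inter> S) = 1" by simp
          moreover have "{v,c,d,r} \<subseteq> V"
            using sc(2) d(2) v(1-3) *(3) less.prems(2) by auto
          ultimately show False using no_dia[OF dia] by blast
        next
          case False
          let ?N = "{{v,a},{a,b},{v,b},{s,c},{s,r},{c,r}}"
          have "s \<noteq> a" "s \<noteq> b" "s \<noteq> r" "v \<noteq> r" using sc(1) ab r v(1) by auto
          then have "card ?N = 6"
            using sc(2) neq r False by (auto simp: doubleton_eq_iff)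
          moreover have "card (insert r ?S) = card S + 3" using r cS' finS' by simp
          moreover have "?N \<subseteq> edges_in E (insert r ?S)"
            using that v by (auto simp: edges_in_def)
          moreover have "\<not> e \<subseteq> S" if "e \<in> ?N" for e
            using that \<open>c = a \<or> c = b\<close> ab r by auto
          ultimately have "excess E (insert r ?S) \<le> excess E S + 30 - 42"
            using excess_extend[of "insert r ?S" S ?N E 3] finS' by auto
          moreover have "0 \<le> excess E (insert r ?S)"
            using \<open>card (insert r ?S) = card S + 3\<close> less.prems(5,7) finS' by (intro excess_nonneg) auto
          ultimately show False using less.prems(6) by simp
        qed
        have two: False if "tri a b r"
        proof -
          have "diamond a b v r"
            using that v edge_sym r unfolding diamond_def by auto
          moreover have "{a,b,v,r} \<inter> S = {v}" using v(1) ab r by auto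
          then have "card ({a,b,v,r} \<inter> S) = 1" by simp
          moreover have "{a,b,v,r} \<subseteq> V" using v(1-3) *(3) less.prems(2) by auto
          ultimately show False using no_dia by blast
        qed
        have "tri q p r" using * edge_sym by blast
        moreover have "p \<noteq> q" using * edge_neq by blast
        moreover have "\<not> (p \<in> S \<and> q \<in> S)"
          using * r tight unfolding triangle_tight_def by blast
        ultimately show False
          using * one[of p q] one[of q p] two by (auto simp: edge_sym)
      qed
    qed
    have m: "matched ?S"
      using matched_insert_triangle[OF tight less.prems(3)] v ab neq by blast
    have "\<exists>S'. ?S \<subseteq> S' \<and> S' \<subseteq> V \<and> matched S' \<and> triangle_closed V S'"
    proof (rule less.hyps)
      show "nat (excess E ?S) < nat (excess E S)" using ex \<open>0 \<le> excess E ?S\<close> by simp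
      \<comment> \<open>From at most 5 the excess falls to at most 4; above 5 there is no diamond in
        \<open>V\<close> at all. The last hypothesis serves to hand on the one before it.\<close>
      show "excess E ?S \<le> 4 \<or> (\<forall>x y z w. diamond x y z w \<longrightarrow> {x,y,z,w} \<subseteq> V \<longrightarrow> card ({x,y,z,w} \<inter> ?S) \<noteq> 1)"
        using less.prems(9) ex by auto
      show "excess E ?S \<le> 5 \<or> (\<forall>x y z w. diamond x y z w \<longrightarrow> \<not> {x,y,z,w} \<subseteq> V)"
        using less.prems(9) ex by auto
    qed (use less.prems(1,2,5-7) v m tight' ex \<open>0 \<le> excess E ?S\<close> cS' in simp_all)
    then show ?thesis by blast
  qed
qed

text \<open>With excess at most 1 neither a triangle along an edge, at cost 4, nor a diamond at a
  vertex, at cost 5, can be paid for, so all conditions of \<open>grow_closed\<close> hold.\<close>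

lemma grow_closed_small:
  assumes "finite V" "S \<subseteq> V" "matched S" "card S \<le> 7" "excess E S \<le> 1"
  shows "\<exists>S'. S \<subseteq> S' \<and> S' \<subseteq> V \<and> matched S' \<and> triangle_closed V S'"
proof -
  have "finite S" using assms finite_subset by blast
  then show ?thesis
    using assms excess_nonneg[of S] triangle_tight_small_excess[of S V]
    by (intro grow_closed) auto
qed

section \<open>Dense cores around a diamond\<close>

lemma non_edge_diamond:
  assumes "diamond x y z w"
  shows "{z,w} \<notin> E"
proof
  assume "{z,w} \<in> E"
  note neq = diamond_neq[OF assms]
  let ?N = "{{x,y},{x,z},{x,w},{y,z},{y,w},{z,w}}"
  have "card ?N = 6" using neq by (auto simp: doubleton_eq_iff)
  moreover have "?N \<subseteq> edges_in E {x,y,z,w}"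
    using assms \<open>{z,w} \<in> E\<close> by (auto simp: edges_in_def diamond_def)
  moreover have "card {x,y,z,w} = 4" using neq by simp
  \<comment> \<open>A complete graph on four vertices has excess 40 - 42.\<close>
  ultimately show False
    using excess_le[of "{x,y,z,w}" ?N E 4] excess_nonneg[of "{x,y,z,w}"] by auto
qed

lemma hits_triangles_diamond:
  assumes "diamond x y z w"
  shows "hits_triangles E {{x,y}} {x,y,z,w}"
  unfolding hits_triangles_def
proof (intro ballI impI)
  fix a b c assume *: "a \<in> {x,y,z,w}" "b \<in> {x,y,z,w}" "c \<in> {x,y,z,w}" "tri a b c"
  have "a \<noteq> b" "b \<noteq> c" "a \<noteq> c" using * edge_neq by blast+
  moreover have "{z,w} \<notin> E" "{w,z} \<notin> E" using non_edge_diamond[OF assms] edge_sym by auto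
  ultimately have "{x,y} \<subseteq> {a,b,c}" using * by auto
  then show "\<exists>q\<in>{{x,y}}. q \<subseteq> {a,b,c}" by blast
qed

text \<open>Three triangles share the spine: five vertices and seven edges leave excess at most 1.
  Any two of the three tips form a diamond with the spine and are therefore not adjacent, so the
  spine hits every triangle.\<close>

lemma matched_book:
  assumes "diamond x y z w" "{x,t} \<in> E" "{y,t} \<in> E" "t \<notin> {x,y,z,w}"
  shows "matched {x,y,z,w,t} \<and> excess E {x,y,z,w,t} \<le> 1"
proof -
  note neq = diamond_neq[OF assms(1)]
  let ?S = "{x,y,z,w,t}" and ?N = "{{x,y},{x,z},{x,w},{y,z},{y,w},{x,t},{y,t}}"
  have "card ?N = 7" using neq assms by (auto simp: doubleton_eq_iff)
  moreover have "?N \<subseteq> edges_in E ?S"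
    using assms by (auto simp: edges_in_def diamond_def)
  moreover have "card ?S = 5" using neq assms(4) by auto
  ultimately have ex: "excess E ?S \<le> 1"
    using excess_le[of ?S ?N E 5] by auto
  have "diamond x y z t" "diamond x y w t"
    using assms unfolding diamond_def by (auto simp: edge_sym)
  then have ne: "{z,w} \<notin> E" "{z,t} \<notin> E" "{w,t} \<notin> E" "{w,z} \<notin> E" "{t,z} \<notin> E" "{t,w} \<notin> E"
    using non_edge_diamond assms(1) edge_sym by blast+
  have "hits_triangles E {{x,y}} ?S"
    unfolding hits_triangles_def
  proof (intro ballI impI)
    fix a b c assume *: "a \<in> ?S" "b \<in> ?S" "c \<in> ?S" "tri a b c"
    have "a \<noteq> b" "b \<noteq> c" "a \<noteq> c" using * edge_neq by blast+
    then have "{x,y} \<subseteq> {a,b,c}" using * ne by auto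
    then show "\<exists>q\<in>{{x,y}}. q \<subseteq> {a,b,c}" by blast
  qed
  moreover have "matching_in {{x,y}} ?S" using neq by (auto simp: matching_in_def)
  ultimately show ?thesis using ex by (auto simp: matched_def)
qed

text \<open>The hub is \<open>x\<close> and the path is \<open>w\<close>, \<open>y\<close>,
  \<open>z\<close>, \<open>t\<close>. The edge closing the path to a wheel would give eight edges on
  five vertices, excess 50 - 56; without it the two chosen pairs hit every triangle.\<close>

lemma matched_fan:
  assumes "diamond x y z w" "{x,t} \<in> E" "{z,t} \<in> E" "t \<notin> {x,y,z,w}"
  shows "matched {x,y,z,w,t} \<and> excess E {x,y,z,w,t} \<le> 1"
proof -
  note neq = diamond_neq[OF assms(1)]
  let ?S = "{x,y,z,w,t}" and ?N = "{{x,y},{x,z},{x,w},{y,z},{y,w},{x,t},{z,t}}"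
  have "card ?N = 7" using neq assms by (auto simp: doubleton_eq_iff)
  moreover have N: "?N \<subseteq> edges_in E ?S"
    using assms by (auto simp: edges_in_def diamond_def)
  moreover have card: "card ?S = 5" using neq assms(4) by auto
  ultimately have ex: "excess E ?S \<le> 1"
    using excess_le[of ?S ?N E 5] by auto
  have "{w,t} \<notin> E"
  proof
    assume "{w,t} \<in> E"
    then have "insert {w,t} ?N \<subseteq> edges_in E ?S" using N by (auto simp: edges_in_def)
    moreover have "card (insert {w,t} ?N) = 8"
      using neq assms \<open>card ?N = 7\<close> by (subst card_insert_disjoint) (auto simp: doubleton_eq_iff)
    ultimately have "excess E ?S \<le> 50 - 56"
      using excess_le[of ?S "insert {w,t} ?N" E 5] card by auto
    then show False using excess_nonneg[of ?S] card by auto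
  qed
  then have ne: "{z,w} \<notin> E" "{w,t} \<notin> E" "{w,z} \<notin> E" "{t,w} \<notin> E"
    using non_edge_diamond assms(1) edge_sym by blast+
  have "hits_triangles E {{x,y},{z,t}} ?S"
    unfolding hits_triangles_def
  proof (intro ballI impI)
    fix a b c assume *: "a \<in> ?S" "b \<in> ?S" "c \<in> ?S" "tri a b c"
    have "a \<noteq> b" "b \<noteq> c" "a \<noteq> c" using * edge_neq by blast+
    then have "{x,y} \<subseteq> {a,b,c} \<or> {z,t} \<subseteq> {a,b,c}" using * ne by auto
    then show "\<exists>q\<in>{{x,y},{z,t}}. q \<subseteq> {a,b,c}" by blast
  qed
  moreover have "matching_in {{x,y},{z,t}} ?S"
    using neq assms by (auto simp: matching_in_def pairwise_def disjnt_def)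
  ultimately show ?thesis using ex by (auto simp: matched_def)
qed

text \<open>Up to the symmetries of the diamond, the third triangle stands on the spine and gives a
  book, or on one of the four sides and gives a fan; the tips are not adjacent.\<close>

lemma matched_diamond_triangle:
  assumes "diamond x y z w" "a \<in> {x,y,z,w}" "b \<in> {x,y,z,w}" "t \<notin> {x,y,z,w}" "tri a b t"
  shows "matched {x,y,z,w,t} \<and> excess E {x,y,z,w,t} \<le> 1"
proof -
  have d: "diamond x y z w" "diamond y x z w" "diamond x y w z" "diamond y x w z"
    using assms(1) diamond_sym by blast+
  have "a \<noteq> b" using assms edge_neq by blast
  have ne: "{z,w} \<notin> E" "{w,z} \<notin> E" using non_edge_diamond[OF d(1)] edge_sym by auto
  have e: "{a,t} \<in> E" "{b,t} \<in> E" using assms by auto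
  have S: "{y,x,z,w,t} = {x,y,z,w,t}" "{x,y,w,z,t} = {x,y,z,w,t}" "{y,x,w,z,t} = {x,y,z,w,t}"
    by auto
  have t: "t \<notin> {y,x,z,w}" "t \<notin> {x,y,w,z}" "t \<notin> {y,x,w,z}" using assms by auto
  consider "{a,b} = {x,y}" | "{a,b} = {x,z}" | "{a,b} = {x,w}" | "{a,b} = {y,z}" | "{a,b} = {y,w}" | "{a,b} = {z,w}"
    using assms(2,3) \<open>a \<noteq> b\<close> by auto
  then show ?thesis
  proof cases
    case 1 then show ?thesis using matched_book[OF d(1)] e assms(4) by (auto simp: doubleton_eq_iff)
  next
    case 2 then show ?thesis using matched_fan[OF d(1)] e assms(4) by (auto simp: doubleton_eq_iff)
  next
    case 3 then show ?thesis using matched_fan[OF d(3), of t] e t S by (auto simp: doubleton_eq_iff)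
  next
    case 4 then show ?thesis using matched_fan[OF d(2), of t] e t S by (auto simp: doubleton_eq_iff)
  next
    case 5 then show ?thesis using matched_fan[OF d(4), of t] e t S by (auto simp: doubleton_eq_iff)
  next
    case 6 then show ?thesis using ne assms(5) by auto
  qed
qed

lemma diamond_spine_sym:
  "diamond x y z w \<Longrightarrow> p \<in> {x,y} \<Longrightarrow> \<exists>q. diamond p q z w \<and> {p,q} = {x,y}"
  using diamond_sym(1)[of x y z w] by (cases "p = x") auto

text \<open>If the common vertex lay on both spines, it would be the centre of a double diamond. So
  the spines are disjoint and form the matching.\<close>

lemma matched_two_diamonds:
  assumes d: "diamond x y z w" "diamond x' y' z' w'"
    and V: "{x,y,z,w} \<subseteq> V" "{x',y',z',w'} \<subseteq> V"
    and card: "card ({x',y',z',w'} \<inter> {x,y,z,w}) = 1"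
    and tight: "triangle_tight V {x,y,z,w}" "triangle_tight V {x',y',z',w'}"
    and "\<not> has_DD V"
  shows "matched ({x,y,z,w} \<union> {x',y',z',w'})"
proof -
  let ?D = "{x,y,z,w}" and ?D' = "{x',y',z',w'}"
  obtain p where p: "?D' \<inter> ?D = {p}" using card by (rule card_1_singletonE)
  note neq = diamond_neq[OF d(1)] diamond_neq[OF d(2)]
  have disj: "{x,y} \<inter> {x',y'} = {}"
  proof (rule ccontr)
    assume "{x,y} \<inter> {x',y'} \<noteq> {}"
    then obtain s where s: "s \<in> {x,y}" "s \<in> {x',y'}" by blast
    then have "s \<in> ?D' \<inter> ?D" by blast
    then have "s = p" using p by blast
    with s have pp: "p \<in> {x,y}" "p \<in> {x',y'}" by auto
    obtain q q' where q: "diamond p q z w" "{p,q} = {x,y}" "diamond p q' z' w'" "{p,q'} = {x',y'}"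
      using diamond_spine_sym[OF d(1) pp(1)] diamond_spine_sym[OF d(2) pp(2)] by blast
    have D: "?D = {p,q,z,w}" "?D' = {p,q',z',w'}" using q by auto
    note n = diamond_neq[OF q(1)] diamond_neq[OF q(3)]
    have "t \<notin> {q,z,w}" if "t \<in> {q',z',w'}" for t
    proof
      assume "t \<in> {q,z,w}"
      then have "t \<in> ?D' \<inter> ?D" using that unfolding D by blast
      then have "t = p" using p by blast
      then show False using that n by auto
    qed
    then have "distinct [p,q,z,w,q',z',w']" using n by auto
    moreover have "{p,q,z,w,q',z',w'} \<subseteq> V" using V D by auto
    ultimately have "has_DD V" using q(1,3) by (intro has_DDI[of p q z w q' z' w'])
    then show False using \<open>\<not> has_DD V\<close> by blast
  qed
  have "hits_triangles E {{x,y},{x',y'}} (?D \<union> ?D')"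
    unfolding hits_triangles_def
  proof (intro ballI impI)
    fix a b c assume *: "a \<in> ?D \<union> ?D'" "b \<in> ?D \<union> ?D'" "c \<in> ?D \<union> ?D'" "tri a b c"
    have inV: "a \<in> V" "b \<in> V" "c \<in> V" using * V by auto
    have **: "tri b c a" "tri a c b" using * edge_sym by blast+
    have t1: "w0 \<in> ?D" if "u0 \<in> ?D" "v0 \<in> ?D" "tri u0 v0 w0" "w0 \<in> V" for u0 v0 w0
      using tight(1) that unfolding triangle_tight_def by blast
    have t2: "w0 \<in> ?D'" if "u0 \<in> ?D'" "v0 \<in> ?D'" "tri u0 v0 w0" "w0 \<in> V" for u0 v0 w0
      using tight(2) that unfolding triangle_tight_def by blast
    \<comment> \<open>Two of the three vertices lie in the same diamond, and tightness pulls in the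
      third.\<close>
    have "(a \<in> ?D \<and> b \<in> ?D) \<or> (b \<in> ?D \<and> c \<in> ?D) \<or> (a \<in> ?D \<and> c \<in> ?D) \<or>
        (a \<in> ?D' \<and> b \<in> ?D') \<or> (b \<in> ?D' \<and> c \<in> ?D') \<or> (a \<in> ?D' \<and> c \<in> ?D')"
      using *(1-3) by blast
    then have "(a \<in> ?D \<and> b \<in> ?D \<and> c \<in> ?D) \<or> (a \<in> ?D' \<and> b \<in> ?D' \<and> c \<in> ?D')"
      using t1[of a b c] t1[of b c a] t1[of a c b] t2[of a b c] t2[of b c a] t2[of a c b] *(4) ** inV
      by argo
    then have "(\<exists>q\<in>{{x,y}}. q \<subseteq> {a,b,c}) \<or> (\<exists>q\<in>{{x',y'}}. q \<subseteq> {a,b,c})"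
      using hits_triangles_diamond[OF d(1)] hits_triangles_diamond[OF d(2)] *(4)
      unfolding hits_triangles_def by meson
    then show "\<exists>q\<in>{{x,y},{x',y'}}. q \<subseteq> {a,b,c}" by blast
  qed
  moreover have "matching_in {{x,y},{x',y'}} (?D \<union> ?D')"
    using neq disj by (auto simp: matching_in_def pairwise_def disjnt_def)
  ultimately show ?thesis by (auto simp: matched_def)
qed

lemma excess_diamond:
  assumes "diamond x y z w"
  shows "excess E {x,y,z,w} \<le> 5"
proof -
  note neq = diamond_neq[OF assms]
  let ?N = "{{x,y},{x,z},{x,w},{y,z},{y,w}}"
  have "card ?N = 5" using neq by (auto simp: doubleton_eq_iff)
  moreover have "?N \<subseteq> edges_in E {x,y,z,w}"
    using assms by (auto simp: edges_in_def diamond_def)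
  moreover have "card {x,y,z,w} = 4" using neq by simp
  ultimately show ?thesis
    using excess_le[of "{x,y,z,w}" ?N E 4] by auto
qed

text \<open>The starting set is as dense as possible: a diamond with a triangle along an edge, two
  diamonds sharing one vertex, a diamond, or a triangle. The first two leave excess at most 1; for
  the last two, the absence of denser starts supplies the hypotheses of
  \<open>grow_closed\<close>.\<close>

lemma exists_closed_matched:
  assumes "finite V" "\<not> has_DD V" "{a,b,c} \<subseteq> V" "tri a b c"
  shows "\<exists>S. S \<noteq> {} \<and> S \<subseteq> V \<and> matched S \<and> triangle_closed V S"
proof (cases "\<exists>x y z w. diamond x y z w \<and> {x,y,z,w} \<subseteq> V \<and> \<not> triangle_tight V {x,y,z,w}")
  case True
  then obtain x y z w p q t where d: "diamond x y z w" "{x,y,z,w} \<subseteq> V"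
      "p \<in> {x,y,z,w}" "q \<in> {x,y,z,w}" "t \<in> V" "tri p q t" "t \<notin> {x,y,z,w}"
    unfolding triangle_tight_def by blast
  have m: "matched {x,y,z,w,t}" "excess E {x,y,z,w,t} \<le> 1"
    using matched_diamond_triangle[OF d(1,3,4,7,6)] by auto
  have "card {x,y,z,w,t} \<le> 7" by (simp add: card_insert_if)
  then show ?thesis
    using grow_closed_small[OF assms(1) _ m(1) _ m(2)] d(2,5) by blast
next
  case False
  then have tight: "triangle_tight V {x,y,z,w}" if "diamond x y z w" "{x,y,z,w} \<subseteq> V" for x y z w
    using that by blast
  show ?thesis
  proof (cases "\<exists>x y z w. diamond x y z w \<and> {x,y,z,w} \<subseteq> V")
    case True
    then obtain x y z w where d: "diamond x y z w" "{x,y,z,w} \<subseteq> V" by blast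
    let ?D = "{x,y,z,w}"
    note neq = diamond_neq[OF d(1)]
    have c4: "card ?D = 4" using neq by simp
    have ex: "excess E ?D \<le> 5" using excess_diamond[OF d(1)] .
    show ?thesis
    proof (cases "\<exists>x' y' z' w'. diamond x' y' z' w' \<and> {x',y',z',w'} \<subseteq> V \<and> card ({x',y',z',w'} \<inter> ?D) = 1")
      case True
      then obtain x' y' z' w' where d': "diamond x' y' z' w'" "{x',y',z',w'} \<subseteq> V"
          "card ({x',y',z',w'} \<inter> ?D) = 1" by blast
      let ?S = "?D \<union> {x',y',z',w'}"
      have m: "matched ?S"
        using matched_two_diamonds[OF d(1) d'(1) d(2) d'(2,3) tight[OF d] tight[OF d'(1,2)] assms(2)] .
      have e: "excess E ?S \<le> 1"
        using excess_diamond_at_vertex[of ?D, OF _ d'(1,3)] ex by simp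
      have "card ?S + card ({x',y',z',w'} \<inter> ?D) = card ?D + card {x',y',z',w'}"
        using card_Un_Int[of ?D "{x',y',z',w'}"] by (simp add: Int_commute)
      moreover have "card {x',y',z',w'} \<le> 4" by (simp add: card_insert_if)
      ultimately have "card ?S \<le> 7" using c4 d'(3) by linarith
      then show ?thesis
        using grow_closed_small[OF assms(1) _ m _ e] d(2) d'(2) by blast
    next
      case no: False
      have "matching_in {{x,y}} ?D" using neq by (auto simp: matching_in_def)
      then have m: "matched ?D" using hits_triangles_diamond[OF d(1)] by (auto simp: matched_def)
      have "\<exists>S'. ?D \<subseteq> S' \<and> S' \<subseteq> V \<and> matched S' \<and> triangle_closed V S'"
        using excess_nonneg[of ?D] ex no c4
        by (intro grow_closed[OF assms(1) d(2) m tight[OF d]]) auto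
      then show ?thesis by blast
    qed
  next
    case no: False
    let ?T = "{a,b,c}"
    have neq: "a \<noteq> b" "b \<noteq> c" "a \<noteq> c" using assms edge_neq by blast+
    have "card {{a,b},{b,c},{a,c}} = 3" using neq by (auto simp: doubleton_eq_iff)
    moreover have c3: "card ?T = 3" using neq by simp
    ultimately have ex: "excess E ?T \<le> 9"
      using excess_le[of ?T "{{a,b},{b,c},{a,c}}" E 3] assms(4) by (auto simp: edges_in_def)
    have "hits_triangles E {{a,b}} ?T"
      unfolding hits_triangles_def
    proof (intro ballI impI)
      fix p q r assume *: "p \<in> ?T" "q \<in> ?T" "r \<in> ?T" "tri p q r"
      have "p \<noteq> q" "q \<noteq> r" "p \<noteq> r" using * edge_neq by blast+
      then have "{a,b} \<subseteq> {p,q,r}" using * by auto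
      then show "\<exists>e\<in>{{a,b}}. e \<subseteq> {p,q,r}" by blast
    qed
    moreover have "matching_in {{a,b}} ?T" using neq by (auto simp: matching_in_def)
    ultimately have m: "matched ?T" by (auto simp: matched_def)
    have tightT: "triangle_tight V ?T"
      unfolding triangle_tight_def
    proof (intro ballI impI)
      fix p q r assume *: "p \<in> ?T" "q \<in> ?T" "r \<in> V" "tri p q r"
      show "r \<in> ?T"
      proof (rule ccontr)
        assume r: "r \<notin> ?T"
        have "p \<noteq> q" using * edge_neq by blast
        then obtain s where s: "s \<in> ?T" "s \<noteq> p" "s \<noteq> q" using neq *(1,2) by auto
        then have "tri p q s" using *(1,2) \<open>p \<noteq> q\<close> assms(4) by (auto simp: edge_sym)
        then have "diamond p q s r" using * s r unfolding diamond_def by auto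
        then show False using no * s assms(3) by blast
      qed
    qed
    have "\<exists>S'. ?T \<subseteq> S' \<and> S' \<subseteq> V \<and> matched S' \<and> triangle_closed V S'"
    proof (rule grow_closed[OF assms(1,3) m tightT])
      show "excess E ?T \<le> 4 \<or> (\<forall>x y z w. diamond x y z w \<longrightarrow> {x,y,z,w} \<subseteq> V \<longrightarrow> card ({x,y,z,w} \<inter> ?T) \<noteq> 1)"
        using no by blast
      show "excess E ?T \<le> 5 \<or> (\<forall>x y z w. diamond x y z w \<longrightarrow> \<not> {x,y,z,w} \<subseteq> V)"
        using no by blast
    qed (use excess_nonneg[of ?T] ex c3 in simp_all)
    then show ?thesis by blast
  qed
qed

text \<open>Closed sets are split off one at a time. No triangle of \<open>V\<close> meets both
  \<open>S\<close> and \<open>V - S\<close>, so the two matchings unite.\<close>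

lemma matched_if_no_DD:
  assumes "finite V" "\<not> has_DD V"
  shows "matched V"
  using assms
proof (induction "card V" arbitrary: V rule: less_induct)
  case less
  show ?case
  proof (cases "\<exists>a\<in>V. \<exists>b\<in>V. \<exists>c\<in>V. tri a b c")
    case False
    then have "hits_triangles E {} V" unfolding hits_triangles_def by blast
    then show ?thesis unfolding matched_def by (auto intro!: exI[of _ "{}"] simp: matching_in_def)
  next
    case True
    then obtain a b c where abc: "{a,b,c} \<subseteq> V" "tri a b c" by blast
    then obtain S where S: "S \<noteq> {}" "S \<subseteq> V" "matched S" "triangle_closed V S"
      using exists_closed_matched[OF less.prems abc] by blast
    have "card (V - S) < card V"
      using S less.prems by (intro psubset_card_mono) auto
    moreover have "\<not> has_DD (V - S)"
      using less.prems(2) unfolding has_DD_def by (meson Diff_subset order_trans)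
    ultimately have "matched (V - S)" using less.hyps less.prems(1) by simp
    then obtain Q R where Q: "matching_in Q S" "hits_triangles E Q S"
        "matching_in R (V - S)" "hits_triangles E R (V - S)"
      using S(3) unfolding matched_def by blast
    have "S \<union> (V - S) = V" using S by blast
    then have "matching_in (Q \<union> R) V" using matching_in_Un[OF Q(1,3)] by auto
    moreover have "hits_triangles E (Q \<union> R) V"
      unfolding hits_triangles_def
    proof (intro ballI impI)
      fix a b c assume *: "a \<in> V" "b \<in> V" "c \<in> V" "tri a b c"
      have **: "tri b a c" "tri c b a" using * edge_sym by blast+
      have cl: "v \<in> S \<and> w \<in> S" if "u \<in> S" "v \<in> V" "w \<in> V" "tri u v w" for u v w
        using S(4) that unfolding triangle_closed_def by blast
      have "(a \<in> S \<and> b \<in> S \<and> c \<in> S) \<or> (a \<in> V - S \<and> b \<in> V - S \<and> c \<in> V - S)"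
        using cl[of a b c] cl[of b a c] cl[of c b a] * ** by blast
      then have "(\<exists>q\<in>Q. q \<subseteq> {a,b,c}) \<or> (\<exists>q\<in>R. q \<subseteq> {a,b,c})"
        using Q(2,4) *(4) unfolding hits_triangles_def by meson
      then show "\<exists>q\<in>Q \<union> R. q \<subseteq> {a,b,c}" by blast
    qed
    ultimately show ?thesis by (auto simp: matched_def)
  qed
qed

end


section \<open>Double diamonds decide the game\<close>

lemma Union_DD: "\<Union>DD = {0..<7}"
  unfolding DD_def by (auto simp: numeral_eq_Suc less_Suc_eq)

lemma card_DD: "card DD = 10"
  unfolding DD_def by (auto simp: doubleton_eq_iff)

lemma atLeastLessThan_7: "{0..<7} = {0,1,2,3,4,5,6::nat}"
  by (auto simp: numeral_eq_Suc less_Suc_eq)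

lemma copies_DD_E:
  assumes "c \<in> copies n DD G"
  obtains f where "inj_on f {0..<7}" "f ` {0..<7} \<subseteq> {0..<n}" "c = (\<lambda>e. f ` e) ` DD" "c \<subseteq> G"
    "card c = 10" "\<Union>c = f ` {0..<7}"
proof -
  obtain f where f: "inj_on f {0..<7}" "f ` {0..<7} \<subseteq> {0..<n}" "c = (\<lambda>e. f ` e) ` DD" "c \<subseteq> G"
    using assms unfolding copies_def Union_DD by blast
  have "inj_on (\<lambda>e. f ` e) DD" using f(1) by (intro inj_on_image) (simp add: Union_DD)
  then have "card c = 10" using f(3) card_DD by (simp add: card_image)
  moreover have "\<Union>c = f ` {0..<7}" using f(3) Union_DD by (metis image_Union)
  ultimately show ?thesis using that f by blast
qed

lemma copies_mono:
  assumes "G \<subseteq> G'"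
  shows "copies n F G \<subseteq> copies n F G'"
proof
  fix c assume "c \<in> copies n F G"
  then obtain f where "inj_on f (\<Union>F)" "f ` \<Union>F \<subseteq> {0..<n}" "c = (\<lambda>e. f ` e) ` F" "c \<subseteq> G"
    unfolding copies_def by blast
  then show "c \<in> copies n F G'"
    unfolding copies_def using assms by (intro CollectI exI[of _ f]) auto
qed

lemma enforcer_wins_copy:
  assumes "c \<in> copies n DD G"
  shows "enforcer_wins G (\<Union>c) {} True \<and> \<Union>c \<subseteq> {0..<n} \<and> card (\<Union>c) = 7"
proof -
  obtain f where f: "inj_on f {0..<7}" "f ` {0..<7} \<subseteq> {0..<n}" "c = (\<lambda>e. f ` e) ` DD" "c \<subseteq> G"
      "\<Union>c = f ` {0..<7}"
    using copies_DD_E[OF assms] by metis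
  have "enforcer_wins DD {0..<7} {} True"
    using enforcer_wins_DD atLeastLessThan_7 by simp
  from enforcer_wins_image[OF this f(1)] have "enforcer_wins c (\<Union>c) {} True" using f by simp
  then have "enforcer_wins G (\<Union>c) {} True" using enforcer_wins_mono f(4) by blast
  moreover have "card (\<Union>c) = 7" using card_image[OF f(1)] f(5) by simp
  ultimately show ?thesis using f by simp
qed

text \<open>Surplus vertices are absorbed in pairs; if their number is odd, Enforcer opens with one
  of them. The player who moves last is the same on \<open>V\<close> as on \<open>W\<close>.\<close>

lemma enforcer_wins_extend:
  assumes "enforcer_wins E W {} True" "finite V" "W \<subseteq> V"
  shows "enforcer_wins E V {} (even (card (V - W)))"
proof (cases "even (card (V - W))")
  case True
  then have "enforcer_wins E (W \<union> (V - W)) {} True"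
    using assms by (intro enforcer_wins_absorb_even) auto
  moreover have "W \<union> (V - W) = V" using assms by blast
  ultimately show ?thesis using True by simp
next
  case False
  then obtain r where r: "r \<in> V - W" by (metis card.empty equals0I even_zero)
  then have "even (card (V - W - {r}))" using False assms by (simp add: card_Diff_singleton)
  then have "enforcer_wins E (W \<union> (V - W - {r})) {} True"
    using assms by (intro enforcer_wins_absorb_even) auto
  moreover have "W \<union> (V - W - {r}) = V - {r}" using assms r by blast
  ultimately have "enforcer_wins E (V - {r}) {} True" by simp
  then show ?thesis using r False enforcer_wins.enforcer_move[of r V E "{}"] by simp
qed

lemma has_k_copies_1: "has_k_copies n 1 F G \<longleftrightarrow> copies n F G \<noteq> {}"
proof
  assume "has_k_copies n 1 F G"
  then show "copies n F G \<noteq> {}" unfolding has_k_copies_def by (auto simp: card_1_singleton_iff)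
next
  assume "copies n F G \<noteq> {}"
  then obtain c where "c \<in> copies n F G" by blast
  then show "has_k_copies n 1 F G" unfolding has_k_copies_def by (intro exI[of _ "{c}"]) auto
qed

lemma has_k_copies_2:
  "has_k_copies n 2 F G \<longleftrightarrow> (\<exists>c\<in>copies n F G. \<exists>d\<in>copies n F G. c \<noteq> d)"
proof
  assume "has_k_copies n 2 F G"
  then show "\<exists>c\<in>copies n F G. \<exists>d\<in>copies n F G. c \<noteq> d"
    unfolding has_k_copies_def by (auto simp: card_2_iff)
next
  assume "\<exists>c\<in>copies n F G. \<exists>d\<in>copies n F G. c \<noteq> d"
  then obtain c d where "c \<in> copies n F G" "d \<in> copies n F G" "c \<noteq> d" by blast
  then show "has_k_copies n 2 F G" unfolding has_k_copies_def by (intro exI[of _ "{c,d}"]) auto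
qed

lemma EA_K3_if_DD:
  assumes "has_k_copies n 1 DD G"
  shows "EA_K3 n G"
proof -
  obtain c where "c \<in> copies n DD G" using assms has_k_copies_1 by blast
  from enforcer_wins_copy[OF this]
  have c: "enforcer_wins G (\<Union>c) {} True" "\<Union>c \<subseteq> {0..<n}" "card (\<Union>c) = 7" by auto
  have "finite (\<Union>c)" using c(2) finite_subset by blast
  then have "card ({0..<n} - \<Union>c) = n - 7" using c by (simp add: card_Diff_subset)
  moreover have "7 \<le> n" using card_mono[OF _ c(2)] c(3) by simp
  ultimately have "even (card ({0..<n} - \<Union>c)) \<longleftrightarrow> odd n" by simp
  then show ?thesis
    using enforcer_wins_extend[OF c(1) _ c(2)] unfolding EA_K3_def by simp
qed

text \<open>Deleting an end of a spine leaves at most one spine, and deleting \<open>z\<^sub>1\<close> leaves the single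
  triangle \<open>x y\<^sub>1 z\<^sub>2\<close> on one side, which is hit by \<open>y\<^sub>1 z\<^sub>2\<close>.\<close>

lemma DD_minus_vertex:
  assumes "u \<in> {0..<7}"
  shows "\<exists>R. matching_in R ({0..<7} - {u}) \<and> hits_triangles DD R ({0..<7} - {u})"
proof -
  have adj: "a = 0 \<and> b \<in> {1,2,3,4,5,6} \<or> a = 1 \<and> b \<in> {0,2,3} \<or> a = 4 \<and> b \<in> {0,5,6} \<or>
      a \<in> {2,3} \<and> b \<in> {0,1} \<or> a \<in> {5,6} \<and> b \<in> {0,4}" if "{a,b} \<in> DD" for a b
    using that unfolding DD_def by (auto simp: doubleton_eq_iff)
  have tri: "{0,1} \<subseteq> {a,b,c} \<and> (2 \<in> {a,b,c} \<or> 3 \<in> {a,b,c}) \<or> {0,4} \<subseteq> {a,b,c} \<and> (5 \<in> {a,b,c} \<or> 6 \<in> {a,b,c})"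
    if "{a,b} \<in> DD" "{b,c} \<in> DD" "{a,c} \<in> DD" for a b c
    using adj[OF that(1)] adj[OF that(2)] adj[OF that(3)] by (elim disjE) auto
  have hit: "hits_triangles DD R ({0..<7} - {u})"
    if "\<And>q. q \<in> {{0,1,2},{0,1,3},{0,4,5},{0,4,6}} \<Longrightarrow> u \<notin> q \<Longrightarrow> \<exists>r\<in>R. r \<subseteq> q" for R
    unfolding hits_triangles_def
  proof (intro ballI impI)
    fix a b c assume *: "a \<in> {0..<7} - {u}" "b \<in> {0..<7} - {u}" "c \<in> {0..<7} - {u}"
      "{a,b} \<in> DD \<and> {b,c} \<in> DD \<and> {a,c} \<in> DD"
    then have "\<exists>q\<in>{{0,1,2},{0,1,3},{0,4,5},{0,4,6}}. q \<subseteq> {a,b,c}"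
      using tri[of a b c] by auto
    then obtain q where q: "q \<in> {{0,1,2},{0,1,3},{0,4,5},{0,4,6}}" "q \<subseteq> {a,b,c}" by blast
    moreover have "u \<notin> q" using q(2) * by auto
    ultimately show "\<exists>r\<in>R. r \<subseteq> {a,b,c}" using that[of q] by blast
  qed
  define R where "R = (if u = 0 then {} else if u = 1 then {{0,4}} else if u = 4 then {{0,1}}
    else if u = 2 then {{1,3},{0,4}} else if u = 3 then {{1,2},{0,4}}
    else if u = 5 then {{4,6},{0,1}} else {{4,5},{0,1::nat}})"
  have u: "u \<in> {0,1,2,3,4,5,6}" using assms atLeastLessThan_7 by simp
  have "matching_in R ({0..<7} - {u})"
    using u unfolding R_def matching_in_def pairwise_def disjnt_def by auto
  moreover have "hits_triangles DD R ({0..<7} - {u})"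
    using u by (intro hit) (auto simp: R_def)
  ultimately show ?thesis by blast
qed

section \<open>The outcome of the game on a locally sparse graph\<close>

context sparse_graph
begin

text \<open>Ten edges on seven vertices use up the whole budget, so a copy is an induced
  subgraph.\<close>

lemma copy_tight:
  assumes "c \<in> copies n DD E"
  shows "edges_in E (\<Union>c) = c" "excess E (\<Union>c) = 0"
proof -
  obtain f :: "nat \<Rightarrow> nat" where f: "inj_on f {0..<7}" "c \<subseteq> E" "card c = 10" "\<Union>c = f ` {0..<7}"
    using copies_DD_E[OF assms] by metis
  have fin: "finite (\<Union>c)" and card: "card (\<Union>c) = 7"
    using f card_image[OF f(1)] by auto
  have sub: "c \<subseteq> edges_in E (\<Union>c)" using f(2) by (auto simp: edges_in_def)
  have "card c \<le> card (edges_in E (\<Union>c))" using card_mono[OF finite_edges_in[OF fin] sub] .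
  moreover have "0 \<le> excess E (\<Union>c)" using excess_nonneg fin card by simp
  ultimately have "card (edges_in E (\<Union>c)) = 10"
    using f(3) card unfolding excess_def by linarith
  then show "excess E (\<Union>c) = 0" using card by (simp add: excess_def)
  show "edges_in E (\<Union>c) = c"
    using card_subset_eq[OF finite_edges_in[OF fin] sub] f(3) \<open>card (edges_in E (\<Union>c)) = 10\<close> by simp
qed

text \<open>Excess is submodular: the values at the union and the intersection add up to at most
  those at the two copies, which is 0. So the intersection has excess 0, hence 7 divides its size;
  if nonempty, it is all of both vertex sets, and these determine the copies.\<close>

lemma copies_disjoint:
  assumes c: "c \<in> copies n DD E" and d: "d \<in> copies n DD E" and "c \<noteq> d"
  shows "\<Union>c \<inter> \<Union>d = {}"
proof (rule ccontr)
  assume ne: "\<Union>c \<inter> \<Union>d \<noteq> {}"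
  let ?C = "\<Union>c" and ?D = "\<Union>d"
  have card: "card ?C = 7" "card ?D = 7" using enforcer_wins_copy c d by blast+
  then have fin: "finite ?C" "finite ?D" by (simp_all add: card_ge_0_finite)
  have sub: "edges_in E ?C \<union> edges_in E ?D \<subseteq> edges_in E (?C \<union> ?D)"
    unfolding edges_in_def by blast
  have int: "edges_in E ?C \<inter> edges_in E ?D = edges_in E (?C \<inter> ?D)"
    unfolding edges_in_def by blast
  have "card (edges_in E ?C \<union> edges_in E ?D) \<le> card (edges_in E (?C \<union> ?D))"
    using sub fin by (intro card_mono finite_edges_in) auto
  moreover have "card (edges_in E ?C) + card (edges_in E ?D) =
      card (edges_in E ?C \<union> edges_in E ?D) + card (edges_in E (?C \<inter> ?D))"
    using card_Un_Int[OF finite_edges_in[OF fin(1)] finite_edges_in[OF fin(2)]] int by simp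
  moreover have cUI: "card ?C + card ?D = card (?C \<union> ?D) + card (?C \<inter> ?D)"
    using card_Un_Int[OF fin] .
  moreover have "0 \<le> excess E (?C \<union> ?D)" "0 \<le> excess E (?C \<inter> ?D)"
    using fin cUI card by (auto intro!: excess_nonneg)
  ultimately have "excess E (?C \<inter> ?D) = 0"
    using copy_tight(2)[OF c] copy_tight(2)[OF d] unfolding excess_def by linarith
  then have "10 * card (?C \<inter> ?D) = 7 * card (edges_in E (?C \<inter> ?D))"
    unfolding excess_def by linarith
  then have "7 dvd card (?C \<inter> ?D)" by presburger
  moreover have "card (?C \<inter> ?D) > 0" using ne fin by (simp add: card_gt_0_iff)
  ultimately have "7 \<le> card (?C \<inter> ?D)" by (rule dvd_imp_le)
  then have "?C \<inter> ?D = ?C" "?C \<inter> ?D = ?D"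
    using card_seteq[OF fin(1) Int_lower1] card_seteq[OF fin(2) Int_lower2] card by simp_all
  then have "?C = ?D" by simp
  then have "c = d" using copy_tight(1)[OF c] copy_tight(1)[OF d] by metis
  with \<open>c \<noteq> d\<close> show False by simp
qed

text \<open>Two disjoint copies have 14 vertices, so with Avoider to move Enforcer moves last. A
  single copy has the odd size 7, whence the other parity in \<open>EA_K3_if_DD\<close>.\<close>

lemma EE_K3_if_2DD:
  assumes "has_k_copies n 2 DD E"
  shows "EE_K3 n E"
proof -
  obtain c d where cd: "c \<in> copies n DD E" "d \<in> copies n DD E" "c \<noteq> d"
    using assms has_k_copies_2 by blast
  let ?W = "\<Union>c \<union> \<Union>d"
  note c = enforcer_wins_copy[OF cd(1)] and d = enforcer_wins_copy[OF cd(2)]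
  have disj: "\<Union>c \<inter> \<Union>d = {}" using copies_disjoint cd by blast
  have fin: "finite (\<Union>c)" "finite (\<Union>d)" using c d by (simp_all add: card_ge_0_finite)
  have w: "enforcer_wins E ?W {} True" using enforcer_wins_union c d fin disj by blast
  have sub: "?W \<subseteq> {0..<n}" using c d by blast
  have cW: "card ?W = 14" using card_Un_disjoint[OF fin disj] c d by simp
  have "card ({0..<n} - ?W) = n - 14" using sub fin cW by (simp add: card_Diff_subset)
  moreover have "14 \<le> n" using card_mono[OF _ sub] cW by simp
  ultimately have "even (card ({0..<n} - ?W)) \<longleftrightarrow> even n" by simp
  then show ?thesis
    using enforcer_wins_extend[OF w _ sub] unfolding EE_K3_def by simp
qed

lemma copy_if_has_DD:
  assumes "has_DD V" "V \<subseteq> {0..<n}"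
  shows "\<exists>c\<in>copies n DD E. \<Union>c \<subseteq> V"
proof -
  obtain x y z w y' z' w' where *: "{x,y,z,w,y',z',w'} \<subseteq> V" "distinct [x,y,z,w,y',z',w']"
      "diamond x y z w" "diamond x y' z' w'"
    using assms(1) unfolding has_DD_def by blast
  define f where "f i = [x,y,z,w,y',z',w'] ! i" for i
  have f: "f 0 = x" "f 1 = y" "f 2 = z" "f 3 = w" "f 4 = y'" "f 5 = z'" "f 6 = w'"
    unfolding f_def by simp_all
  have inj: "inj_on f {0..<7}"
    using *(2) unfolding f_def inj_on_def by (auto simp: nth_eq_iff_index_eq)
  have "f ` {0..<7} = {x,y,z,w,y',z',w'}"
    unfolding atLeastLessThan_7 image_insert image_empty f ..
  then have sub: "f ` {0..<7} \<subseteq> V" using *(1) by simp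
  have E: "(\<lambda>e. f ` e) ` DD \<subseteq> E"
    using *(3,4) f unfolding DD_def diamond_def image_insert image_empty by simp
  have "(\<lambda>e. f ` e) ` DD \<in> copies n DD E"
    unfolding copies_def Union_DD using inj sub assms(2) E by blast
  moreover have "\<Union>((\<lambda>e. f ` e) ` DD) = f ` {0..<7}" using Union_DD by (metis image_Union)
  ultimately show ?thesis using sub by (metis (no_types, lifting))
qed

lemma Avoider_wins_if_no_DD:
  assumes "\<not> has_k_copies n 1 DD E"
  shows "\<not> enforcer_wins E {0..<n} {} t"
proof -
  have "\<not> has_DD {0..<n}"
    using copy_if_has_DD[of "{0..<n}" n] assms has_k_copies_1 by blast
  then have "matched {0..<n}" by (intro matched_if_no_DD) auto
  then show ?thesis
    using avoider_wins_matching[of "{0..<n}"] unfolding matched_def by blast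
qed

text \<open>With excess 0 the vertex set of the copy cannot pay for a further triangle, so every
  triangle that meets it lies inside. This separates it from the matching found on the other
  vertices.\<close>

lemma Avoider_wins_if_one_DD:
  assumes "c \<in> copies n DD E" "\<not> has_k_copies n 2 DD E"
  shows "\<not> EE_K3 n E"
proof -
  let ?V = "{0..<n}" and ?W = "\<Union>c"
  obtain f where f: "inj_on f {0..<7}" "f ` {0..<7} \<subseteq> ?V" "c = (\<lambda>e. f ` e) ` DD" "c \<subseteq> E"
      "?W = f ` {0..<7}"
    using copies_DD_E[OF assms(1)] by metis
  have card: "card ?W = 7" using enforcer_wins_copy[OF assms(1)] by blast
  then have fin: "finite ?W" by (simp add: card_ge_0_finite)
  have "\<not> has_DD (?V - ?W)"
  proof
    assume "has_DD (?V - ?W)"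
    then obtain d where d: "d \<in> copies n DD E" "\<Union>d \<subseteq> ?V - ?W"
      using copy_if_has_DD[of "?V - ?W" n] by blast
    have "?W \<noteq> {}" using card by (metis card.empty zero_neq_numeral)
    then have "c \<noteq> d" using d(2) by blast
    then show False using assms d(1) has_k_copies_2 by blast
  qed
  then have "matched (?V - ?W)" by (intro matched_if_no_DD) auto
  then obtain Q where Q: "matching_in Q (?V - ?W)" "hits_triangles E Q (?V - ?W)"
    unfolding matched_def by blast
  have ex: "excess E ?W = 0" using copy_tight[OF assms(1)] by simp
  have tight: "triangle_tight ?V ?W" using triangle_tight_small_excess fin card ex by simp
  have closed: "q \<in> ?W \<and> r \<in> ?W" if "p \<in> ?W" "q \<in> ?V" "r \<in> ?V" "tri p q r" for p q r
  proof (rule ccontr)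
    assume no: "\<not> (q \<in> ?W \<and> r \<in> ?W)"
    have "tri p r q" using that edge_sym by blast
    then have qr: "q \<notin> ?W" "r \<notin> ?W"
      using tight no that unfolding triangle_tight_def by blast+
    have "card (insert q (insert r ?W)) \<le> 30"
      using card fin by (simp add: card_insert_if)
    then have "0 \<le> excess E (insert q (insert r ?W))" using fin by (intro excess_nonneg) auto
    then show False
      using excess_triangle_at_vertex[OF fin that(1) qr that(4)] ex by simp
  qed
  have res: "\<exists>R. matching_in R (?W - {u}) \<and> hits_triangles E (Q \<union> R) (?V - {u})" if u: "u \<in> ?W" for u
  proof -
    obtain i where i: "i \<in> {0..<7}" "u = f i" using u f(5) by auto
    obtain R where R: "matching_in R ({0..<7} - {i})" "hits_triangles DD R ({0..<7} - {i})"
      using DD_minus_vertex[OF i(1)] by blast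
    let ?R = "(\<lambda>e. f ` e) ` R"
    have Wu: "?W - {u} = f ` ({0..<7} - {i})"
      using inj_on_image_set_diff[OF f(1), of "{0..<7}" "{i}"] i f(5) by auto
    have "matching_in ?R (?W - {u})"
      unfolding matching_in_def
    proof (intro conjI ballI)
      fix q assume "q \<in> ?R"
      then obtain r where r: "r \<in> R" "q = f ` r" by blast
      then have r2: "r \<subseteq> {0..<7} - {i}" "card r = 2" using R(1) by (auto simp: matching_in_def)
      show "q \<subseteq> ?W - {u}" using r2 r Wu by auto
      have "inj_on f r" using f(1) r2(1) by (meson Diff_subset inj_on_subset order_trans)
      then show "card q = 2" using r r2 by (simp add: card_image)
    next
      show "pairwise disjnt ?R"
      proof (rule pairwiseI)
        fix p q assume "p \<in> ?R" "q \<in> ?R" "p \<noteq> q"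
        then obtain r s where rs: "r \<in> R" "p = f ` r" "s \<in> R" "q = f ` s" "r \<noteq> s" by blast
        then have "r \<inter> s = {}" "r \<subseteq> {0..<7}" "s \<subseteq> {0..<7}"
          using R(1) by (auto simp: matching_in_def pairwise_def disjnt_def)
        then show "disjnt p q"
          using inj_on_image_Int[OF f(1), of r s] rs by (simp add: disjnt_def)
      qed
    qed
    moreover have "hits_triangles E (Q \<union> ?R) (?V - {u})"
      unfolding hits_triangles_def
    proof (intro ballI impI)
      fix p q r assume *: "p \<in> ?V - {u}" "q \<in> ?V - {u}" "r \<in> ?V - {u}" "tri p q r"
      have **: "tri q p r" "tri r q p" using * edge_sym by blast+
      have "p \<in> ?W \<and> q \<in> ?W \<and> r \<in> ?W \<or> p \<notin> ?W \<and> q \<notin> ?W \<and> r \<notin> ?W"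
        using closed[of p q r] closed[of q p r] closed[of r q p] * ** by blast
      then show "\<exists>e\<in>Q \<union> ?R. e \<subseteq> {p,q,r}"
      proof
        assume "p \<notin> ?W \<and> q \<notin> ?W \<and> r \<notin> ?W"
        then have "\<exists>e\<in>Q. e \<subseteq> {p,q,r}"
          using Q(2) * unfolding hits_triangles_def by blast
        then show ?thesis by blast
      next
        assume W: "p \<in> ?W \<and> q \<in> ?W \<and> r \<in> ?W"
        then have "p \<in> f ` ({0..<7} - {i})" "q \<in> f ` ({0..<7} - {i})" "r \<in> f ` ({0..<7} - {i})"
          using * Wu by auto
        then obtain a b d where abd: "a \<in> {0..<7} - {i}" "p = f a" "b \<in> {0..<7} - {i}" "q = f b"
            "d \<in> {0..<7} - {i}" "r = f d" by blast
        \<comment> \<open>The copy is induced, so adjacency in \<open>E\<close> can be read back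
          through \<open>f\<close>, and the pairs found for \<open>DD\<close> hit the triangles of
          \<open>E\<close>.\<close>
        have pull: "{s,t} \<in> DD" if "{f s, f t} \<in> E" "s \<in> {0..<7}" "t \<in> {0..<7}" for s t
        proof -
          have "{f s, f t} \<in> edges_in E ?W" using that f(5) by (auto simp: edges_in_def)
          then have "{f s, f t} \<in> (\<lambda>e. f ` e) ` DD" using copy_tight(1)[OF assms(1)] f(3) by simp
          then obtain e where e: "e \<in> DD" "f ` {s,t} = f ` e" by auto
          have "e \<subseteq> {0..<7}" using e(1) Union_DD by blast
          then have "{s,t} = e" using inj_on_image_eq_iff[OF f(1), of "{s,t}" e] e(2) that by simp
          then show ?thesis using e by simp
        qed
        have "{a,b} \<in> DD \<and> {b,d} \<in> DD \<and> {a,d} \<in> DD"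
          using pull[of a b] pull[of b d] pull[of a d] abd *(4) by auto
        then obtain e where e: "e \<in> R" "e \<subseteq> {a,b,d}"
          using R(2) abd unfolding hits_triangles_def by meson
        then have "f ` e \<subseteq> {p,q,r}" using abd by auto
        then show ?thesis using e(1) by blast
      qed
    qed
    ultimately show ?thesis by blast
  qed
  have "\<not> enforcer_wins E ?V {} (even (card ?V))"
    using f(2,5) card Q(1) by (intro avoider_wins_reserve_start[of ?V ?W Q] res) auto
  then show ?thesis unfolding EE_K3_def by simp
qed

lemma EA_K3_iff: "EA_K3 n E \<longleftrightarrow> has_k_copies n 1 DD E"
  using EA_K3_if_DD Avoider_wins_if_no_DD unfolding EA_K3_def by blast

lemma EE_K3_iff: "EE_K3 n E \<longleftrightarrow> has_k_copies n 2 DD E"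
proof
  assume EE: "EE_K3 n E"
  then have "has_k_copies n 1 DD E" using Avoider_wins_if_no_DD unfolding EE_K3_def by blast
  then obtain c where "c \<in> copies n DD E" using has_k_copies_1 by blast
  then show "has_k_copies n 2 DD E" using Avoider_wins_if_one_DD EE by blast
qed (rule EE_K3_if_2DD)

end

section \<open>Transfer to the random graph process\<close>

lemma card_edge_Kn: "e \<in> Kn_edges n \<Longrightarrow> card e = 2"
  unfolding Kn_edges_def by auto

text \<open>The properties are shown to agree at every single time, from which equal hitting times
  follow by definition. Times before \<open>m\<close> use that local sparseness passes to
  subgraphs.\<close>

lemma hitting_times_eq:
  assumes xs: "xs \<in> edge_orderings n" and sp: "locally_sparse (process_graph xs m)"
    and two: "has_k_copies n 2 DD (process_graph xs m)"
  shows "hitting_time xs (EA_K3 n) = hitting_time xs (has_k_copies n 1 DD)"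
    "hitting_time xs (EE_K3 n) = hitting_time xs (has_k_copies n 2 DD)"
proof -
  let ?G = "process_graph xs"
  have Kn: "?G i \<subseteq> Kn_edges n" for i
    using xs set_take_subset[of i xs] unfolding edge_orderings_def process_graph_def by auto
  have mono: "?G i \<subseteq> ?G j" if "i \<le> j" for i j
    using that unfolding process_graph_def by (rule set_take_subset_set_take)
  have sg: "sparse_graph (?G i)" if "i \<le> m" for i
  proof
    show "locally_sparse (?G i)"
      unfolding locally_sparse_def
    proof (intro allI impI)
      fix S :: "nat set" assume S: "finite S \<and> card S \<le> 30"
      have "edges_in (?G i) S \<subseteq> edges_in (?G m) S" using mono[OF that] by (auto simp: edges_in_def)
      then have "card (edges_in (?G i) S) \<le> card (edges_in (?G m) S)"
        using S finite_edges_in by (intro card_mono) auto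
      moreover have "0 \<le> excess (?G m) S" using sp S unfolding locally_sparse_def by blast
      ultimately show "0 \<le> excess (?G i) S" unfolding excess_def by linarith
    qed
    show "card e = 2" if "e \<in> ?G i" for e
      using that Kn card_edge_Kn by blast
  qed
  have copies_sub: "copies n DD (?G m) \<subseteq> copies n DD (?G i)" if "m \<le> i" for i
    using copies_mono[OF mono[OF that]] .
  have EEm: "EE_K3 n (?G m)" using sparse_graph.EE_K3_iff[OF sg] two by blast
  have "EA_K3 n (?G i) = has_k_copies n 1 DD (?G i) \<and> EE_K3 n (?G i) = has_k_copies n 2 DD (?G i)" for i
  proof (cases "i \<le> m")
    case True
    then show ?thesis
      using sparse_graph.EA_K3_iff[OF sg[OF True]] sparse_graph.EE_K3_iff[OF sg[OF True]] by simp
  next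
    case False
    then have "m \<le> i" by simp
    have 2: "has_k_copies n 2 DD (?G i)"
      using two copies_sub[OF \<open>m \<le> i\<close>] unfolding has_k_copies_2 by blast
    then have 1: "has_k_copies n 1 DD (?G i)" unfolding has_k_copies_2 has_k_copies_1 by blast
    have "EE_K3 n (?G i)"
      using EEm enforcer_wins_mono[OF _ mono[OF \<open>m \<le> i\<close>]] unfolding EE_K3_def by blast
    then show ?thesis using 1 2 EA_K3_if_DD by blast
  qed
  then show "hitting_time xs (EA_K3 n) = hitting_time xs (has_k_copies n 1 DD)"
    "hitting_time xs (EE_K3 n) = hitting_time xs (has_k_copies n 2 DD)"
    unfolding hitting_time_def by simp_all
qed


section \<open>Uniformly random subsets of fixed size\<close>

lemma edge_orderings_eq: "edge_orderings n = permutations_of_set (Kn_edges n)"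
  unfolding edge_orderings_def permutations_of_set_def by auto

text \<open>Such an ordering splits uniquely into an ordering of \<open>M\<close> followed by one of
  \<open>A - M\<close>.\<close>

lemma card_permutations_take_eq:
  assumes "finite A" "M \<subseteq> A"
  shows "card {xs \<in> permutations_of_set A. set (take (card M) xs) = M} = fact (card M) * fact (card A - card M)"
proof -
  have finM: "finite M" using assms finite_subset by blast
  let ?L = "permutations_of_set M \<times> permutations_of_set (A - M)"
  have "bij_betw (\<lambda>(ys, zs). ys @ zs) ?L {xs \<in> permutations_of_set A. set (take (card M) xs) = M}"
  proof (rule bij_betwI[where g = "\<lambda>xs. (take (card M) xs, drop (card M) xs)"])
    show "(\<lambda>(ys, zs). ys @ zs) \<in> ?L \<rightarrow> {xs \<in> permutations_of_set A. set (take (card M) xs) = M}"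
      using assms by (auto simp: permutations_of_set_def distinct_card)
    show "(\<lambda>xs. (take (card M) xs, drop (card M) xs)) \<in>
        {xs \<in> permutations_of_set A. set (take (card M) xs) = M} \<rightarrow> ?L"
    proof
      fix xs assume "xs \<in> {xs \<in> permutations_of_set A. set (take (card M) xs) = M}"
      then have xs: "set xs = A" "distinct xs" "set (take (card M) xs) = M"
        by (auto simp: permutations_of_set_def)
      have "set (take (card M) xs) \<union> set (drop (card M) xs) = A"
        using xs(1) by (metis append_take_drop_id set_append)
      moreover have "set (take (card M) xs) \<inter> set (drop (card M) xs) = {}"
        using xs(2) by (metis append_take_drop_id distinct_append)
      ultimately have "set (drop (card M) xs) = A - M" using xs(3) by blast
      then show "(take (card M) xs, drop (card M) xs) \<in> ?L"
        using xs by (auto simp: permutations_of_set_def)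
    qed
    show "(take (card M) (case x of (ys, zs) \<Rightarrow> ys @ zs), drop (card M) (case x of (ys, zs) \<Rightarrow> ys @ zs)) = x"
      if "x \<in> ?L" for x
      using that by (auto simp: permutations_of_set_def distinct_card)
  qed auto
  from bij_betw_same_card[OF this, symmetric]
  have "card {xs \<in> permutations_of_set A. set (take (card M) xs) = M} = card ?L" .
  also have "\<dots> = fact (card M) * fact (card (A - M))"
    using assms finM by (simp add: card_cartesian_product)
  finally show ?thesis using assms finM by (simp add: card_Diff_subset)
qed

definition subsets_of_size :: "'a set \<Rightarrow> nat \<Rightarrow> 'a set set" where
  "subsets_of_size A m = {M. M \<subseteq> A \<and> card M = m}"

lemma finite_subsets_of_size: "finite A \<Longrightarrow> finite (subsets_of_size A m)"
  unfolding subsets_of_size_def by (rule finite_subset[of _ "Pow A"]) auto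

lemma card_subsets_of_size: "finite A \<Longrightarrow> card (subsets_of_size A m) = card A choose m"
  unfolding subsets_of_size_def by (rule n_subsets)

text \<open>Every subset of size \<open>m\<close> is the initial part of equally many orderings, so
  the process at time \<open>m\<close> is a uniform subset of that size.\<close>

lemma prob_take_permutation:
  assumes "finite A" "m \<le> card A"
  shows "measure_pmf.prob (pmf_of_set (permutations_of_set A)) {xs. set (take m xs) \<in> B}
    = real (card {M \<in> subsets_of_size A m. M \<in> B}) / real (card A choose m)"
proof -
  let ?P = "permutations_of_set A" and ?S = "{M \<in> subsets_of_size A m. M \<in> B}"
  have fin: "finite ?S" using finite_subsets_of_size[OF assms(1)] by simp
  have ne: "?P \<noteq> {}" using assms(1) by (simp add: permutations_of_set_empty_iff)
  have "?P \<inter> {xs. set (take m xs) \<in> B} = (\<Union>M\<in>?S. {xs \<in> ?P. set (take m xs) = M})"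
  proof (intro equalityI subsetI)
    fix xs assume "xs \<in> ?P \<inter> {xs. set (take m xs) \<in> B}"
    then have xs: "set xs = A" "distinct xs" "set (take m xs) \<in> B" "xs \<in> ?P"
      by (auto simp: permutations_of_set_def)
    have "card (set (take m xs)) = m"
      using xs(1,2) assms(2) distinct_card[of xs] distinct_card[of "take m xs"] by simp
    then have "set (take m xs) \<in> ?S"
      using xs set_take_subset[of m xs] by (auto simp: subsets_of_size_def)
    then show "xs \<in> (\<Union>M\<in>?S. {xs \<in> ?P. set (take m xs) = M})" using xs(4) by blast
  qed auto
  then have "card (?P \<inter> {xs. set (take m xs) \<in> B}) = (\<Sum>M\<in>?S. card {xs \<in> ?P. set (take m xs) = M})"
    using fin by (simp only:) (rule card_UN_disjoint, auto)
  also have "\<dots> = (\<Sum>M\<in>?S. fact m * fact (card A - m))"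
    using card_permutations_take_eq[OF assms(1)] by (intro sum.cong) (auto simp: subsets_of_size_def)
  also have "\<dots> = card ?S * (fact m * fact (card A - m))" by simp
  finally have c: "card (?P \<inter> {xs. set (take m xs) \<in> B}) = card ?S * (fact m * fact (card A - m))" .
  have "measure_pmf.prob (pmf_of_set ?P) {xs. set (take m xs) \<in> B} =
      real (card ?S * (fact m * fact (card A - m))) / fact (card A)"
    using measure_pmf_of_set[OF ne, of "{xs. set (take m xs) \<in> B}"] assms(1) c by simp
  also have "fact (card A) = real (fact m * fact (card A - m) * (card A choose m))"
    using binomial_fact_lemma[OF assms(2)] by (metis of_nat_fact)
  finally show ?thesis by simp
qed

text \<open>For \<open>k \<le> m\<close> and \<open>m \<le> N\<close>, the probability that a
  uniform subset of size \<open>m\<close> of an \<open>N\<close>-element set contains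
  \<open>k\<close> given elements.\<close>

definition subset_ratio :: "nat \<Rightarrow> nat \<Rightarrow> nat \<Rightarrow> real" where
  "subset_ratio N m k = (\<Prod>i<k. (real m - real i) / (real N - real i))"

lemma binomial_subset_ratio:
  assumes "k \<le> m" "m \<le> N"
  shows "real ((N - k) choose (m - k)) = real (N choose m) * subset_ratio N m k"
  using assms
proof (induction k)
  case 0
  then show ?case by (simp add: subset_ratio_def)
next
  case (Suc k)
  let ?n = "N - Suc k" and ?j = "m - Suc k"
  have "Suc ?j * (Suc ?n choose Suc ?j) = Suc ?n * (?n choose ?j)"
    by (rule Suc_times_binomial)
  moreover have "Suc ?n = N - k" "Suc ?j = m - k" using Suc.prems by auto
  ultimately have "real (m - k) * real ((N - k) choose (m - k)) = real (N - k) * real (?n choose ?j)"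
    by (metis of_nat_mult)
  moreover have "real (N - k) > 0" using Suc.prems by simp
  ultimately have "real (?n choose ?j) = real ((N - k) choose (m - k)) * (real (m - k) / real (N - k))"
    by (simp add: field_simps)
  also have "\<dots> = real (N choose m) * subset_ratio N m (Suc k)"
    using Suc by (simp add: subset_ratio_def of_nat_diff)
  finally show ?case .
qed

lemma card_supersets_of_size:
  assumes "finite A" "K \<subseteq> A" "card K \<le> m" "m \<le> card A"
  shows "real (card {M \<in> subsets_of_size A m. K \<subseteq> M}) = real (card A choose m) * subset_ratio (card A) m (card K)"
proof -
  have finK: "finite K" using assms finite_subset by blast
  have "bij_betw (\<lambda>M. M \<union> K) (subsets_of_size (A - K) (m - card K)) {M \<in> subsets_of_size A m. K \<subseteq> M}"
  proof (rule bij_betwI[where g = "\<lambda>M. M - K"])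
    show "(\<lambda>M. M \<union> K) \<in> subsets_of_size (A - K) (m - card K) \<rightarrow> {M \<in> subsets_of_size A m. K \<subseteq> M}"
    proof
      fix M assume "M \<in> subsets_of_size (A - K) (m - card K)"
      then have M: "M \<subseteq> A - K" "card M = m - card K" by (auto simp: subsets_of_size_def)
      then have "finite M" "M \<inter> K = {}" using assms(1) finite_subset[of M A] by auto
      then have "card (M \<union> K) = m" using card_Un_disjoint[of M K] finK M(2) assms(3) by simp
      then show "M \<union> K \<in> {M \<in> subsets_of_size A m. K \<subseteq> M}"
        using M assms(2) by (auto simp: subsets_of_size_def)
    qed
    show "(\<lambda>M. M - K) \<in> {M \<in> subsets_of_size A m. K \<subseteq> M} \<rightarrow> subsets_of_size (A - K) (m - card K)"
      using finK by (auto simp: subsets_of_size_def card_Diff_subset)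
  qed (auto simp: subsets_of_size_def)
  from bij_betw_same_card[OF this, symmetric]
  have "card {M \<in> subsets_of_size A m. K \<subseteq> M} = card (subsets_of_size (A - K) (m - card K))" .
  also have "\<dots> = (card A - card K) choose (m - card K)"
    using assms finK by (simp add: card_subsets_of_size card_Diff_subset)
  finally show ?thesis using binomial_subset_ratio[OF assms(3,4)] by simp
qed

lemma subset_ratio_nonneg: "k \<le> m \<Longrightarrow> m \<le> N \<Longrightarrow> 0 \<le> subset_ratio N m k"
  unfolding subset_ratio_def by (intro prod_nonneg) auto

text \<open>The factors (m - i) / (N - i) decrease in i: containing one set makes containing a
  disjoint one no more likely.\<close>

lemma subset_ratio_add_le:
  assumes "a + b \<le> m" "m \<le> N"
  shows "subset_ratio N m (a + b) \<le> subset_ratio N m a * subset_ratio N m b"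
proof -
  have "subset_ratio N m (a + b) =
      subset_ratio N m a * (\<Prod>i<b. (real m - real (a + i)) / (real N - real (a + i)))"
    unfolding subset_ratio_def by (induction b) (simp_all add: mult.assoc)
  moreover have "(\<Prod>i<b. (real m - real (a + i)) / (real N - real (a + i))) \<le> subset_ratio N m b"
    unfolding subset_ratio_def
  proof (intro prod_mono conjI)
    fix i assume i: "i \<in> {..<b}"
    then have "a + i < m" using assms by simp
    then have pos: "real N - real (a + i) > 0" "real N - real i > 0" "real m - real (a + i) \<ge> 0"
      using assms by linarith+
    then show "0 \<le> (real m - real (a + i)) / (real N - real (a + i))" by simp
    have "real a * real m \<le> real a * real N" using assms by (intro mult_left_mono) auto
    then have "(real m - real (a + i)) * (real N - real i) \<le> (real m - real i) * (real N - real (a + i))"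
      by (simp add: algebra_simps)
    then show "(real m - real (a + i)) / (real N - real (a + i)) \<le> (real m - real i) / (real N - real i)"
      using pos by (simp add: divide_simps mult.commute)
  qed
  ultimately show ?thesis
    using subset_ratio_nonneg[of a m N] assms by (simp add: mult_left_mono)
qed

lemma subset_ratio_le_power:
  assumes "k \<le> m" "m \<le> N"
  shows "subset_ratio N m k \<le> (real m / real N) ^ k"
  using assms
proof (induction k)
  case 0
  then show ?case by (simp add: subset_ratio_def)
next
  case (Suc k)
  have "subset_ratio N m (k + 1) \<le> subset_ratio N m k * subset_ratio N m 1"
    using Suc.prems by (intro subset_ratio_add_le) auto
  also have "\<dots> \<le> (real m / real N) ^ k * (real m / real N)"
    using Suc subset_ratio_nonneg[of k m N] by (intro mult_mono) (auto simp: subset_ratio_def)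
  finally show ?case by (simp add: mult.commute)
qed

text \<open>While at most half of the \<open>m\<close> places are used up, every factor is at least
  \<open>m / N / 2\<close>.\<close>

lemma subset_ratio_ge_power:
  assumes "2 * k \<le> m" "m \<le> N" "0 < m"
  shows "(real m / real N / 2) ^ k \<le> subset_ratio N m k"
proof -
  have "(\<Prod>i<k. real m / real N / 2) \<le> subset_ratio N m k"
    unfolding subset_ratio_def
  proof (intro prod_mono conjI)
    fix i assume "i \<in> {..<k}"
    then have i: "2 * real i \<le> real m" "real N - real i > 0" using assms by auto
    have "real m / real N / 2 = (real m / 2) / real N" by simp
    also have "\<dots> \<le> (real m - real i) / (real N - real i)"
      using i assms by (intro frac_le) auto
    finally show "real m / real N / 2 \<le> (real m - real i) / (real N - real i)" .
  qed auto
  then show ?thesis by simp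
qed

section \<open>Second moment method in counting form\<close>

lemma card_le_second_moment:
  fixes X :: "'a \<Rightarrow> real"
  assumes "finite W" "1 < \<mu>"
  shows "real (card {w \<in> W. X w \<le> 1}) * (\<mu> - 1)\<^sup>2 \<le> (\<Sum>w\<in>W. (X w - \<mu>)\<^sup>2)"
proof -
  have "real (card {w \<in> W. X w \<le> 1}) * (\<mu> - 1)\<^sup>2 = (\<Sum>w\<in>{w \<in> W. X w \<le> 1}. (\<mu> - 1)\<^sup>2)"
    by simp
  also have "\<dots> \<le> (\<Sum>w\<in>{w \<in> W. X w \<le> 1}. (X w - \<mu>)\<^sup>2)"
  proof (rule sum_mono)
    fix w assume "w \<in> {w \<in> W. X w \<le> 1}"
    then have "\<mu> - 1 \<le> \<mu> - X w" by simp
    then have "(\<mu> - 1)\<^sup>2 \<le> (\<mu> - X w)\<^sup>2" using assms(2) by (intro power_mono) auto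
    then show "(\<mu> - 1)\<^sup>2 \<le> (X w - \<mu>)\<^sup>2" by (simp add: power2_commute)
  qed
  also have "\<dots> \<le> (\<Sum>w\<in>W. (X w - \<mu>)\<^sup>2)"
    using assms(1) by (intro sum_mono2) auto
  finally show ?thesis .
qed

text \<open>Disjoint members of the family are negatively correlated, so that only intersecting pairs
  contribute to the variance.\<close>

lemma second_moment_family:
  fixes e :: "'i \<Rightarrow> 'a set"
  assumes A: "finite A" and J: "finite J" and e: "\<And>i. i \<in> J \<Longrightarrow> e i \<subseteq> A \<and> card (e i) = k"
    and m: "2 * k \<le> m" "m \<le> card A"
    and \<mu>: "\<mu> = real (card J) * subset_ratio (card A) m k" "2 \<le> \<mu>"
  shows "real (card {M \<in> subsets_of_size A m. card {i \<in> J. e i \<subseteq> M} \<le> 1}) / real (card A choose m)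
    \<le> 4 / \<mu>\<^sup>2 * (\<Sum>(i,j)\<in>{(i,j) \<in> J \<times> J. e i \<inter> e j \<noteq> {}}. subset_ratio (card A) m (2 * k - card (e i \<inter> e j)))"
proof -
  let ?W = "subsets_of_size A m" and ?r = "subset_ratio (card A) m"
  let ?C = "real (card A choose m)"
  define X where "X M = (\<Sum>i\<in>J. of_bool (e i \<subseteq> M) :: real)" for M
  have X: "X M = real (card {i \<in> J. e i \<subseteq> M})" for M
    unfolding X_def using J by (simp add: sum.If_cases of_bool_def Int_def)
  have finW: "finite ?W" using A by (rule finite_subsets_of_size)
  have cW: "real (card ?W) = ?C" using A by (simp add: card_subsets_of_size)
  have Cpos: "0 < ?C" using m by simp
  \<comment> \<open>Sums over \<open>?W\<close> stay unnormalised: each is \<open>?C\<close> times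
    an expectation for a uniform subset.\<close>
  have sup: "(\<Sum>M\<in>?W. of_bool (K \<subseteq> M)) = ?C * ?r (card K)" if "K \<subseteq> A" "card K \<le> m" for K
  proof -
    have "(\<Sum>M\<in>?W. of_bool (K \<subseteq> M) :: real) = real (card {M \<in> ?W. K \<subseteq> M})"
      using finW by (simp add: sum.If_cases of_bool_def Int_def)
    then show ?thesis using card_supersets_of_size[OF A that m(2)] by simp
  qed
  have k: "k \<le> m" using m by simp
  have S1: "(\<Sum>M\<in>?W. X M) = ?C * \<mu>"
  proof -
    have "(\<Sum>M\<in>?W. X M) = (\<Sum>i\<in>J. \<Sum>M\<in>?W. of_bool (e i \<subseteq> M))"
      unfolding X_def by (rule sum.swap)
    also have "\<dots> = (\<Sum>i\<in>J. ?C * ?r k)" using e sup k by (intro sum.cong) auto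
    finally show ?thesis using \<mu>(1) by simp
  qed
  define g where "g = (\<lambda>(i,j). ?r (card (e i \<union> e j)))"
  have cU: "card (e i \<union> e j) = 2 * k - card (e i \<inter> e j)" if "i \<in> J" "j \<in> J" for i j
  proof -
    have "finite (e i)" "finite (e j)" using e that A finite_subset by blast+
    then show ?thesis using card_Un_Int[of "e i" "e j"] e that by simp
  qed
  have S2: "(\<Sum>M\<in>?W. (X M)\<^sup>2) = ?C * (\<Sum>p\<in>J \<times> J. g p)"
  proof -
    have "(X M)\<^sup>2 = (\<Sum>(i,j)\<in>J \<times> J. of_bool (e i \<union> e j \<subseteq> M))" for M
      unfolding X_def power2_eq_square sum_product sum.cartesian_product
      by (intro sum.cong) auto
    then have "(\<Sum>M\<in>?W. (X M)\<^sup>2) = (\<Sum>M\<in>?W. \<Sum>p\<in>J \<times> J. of_bool (e (fst p) \<union> e (snd p) \<subseteq> M))"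
      by (simp add: case_prod_beta)
    also have "\<dots> = (\<Sum>p\<in>J \<times> J. \<Sum>M\<in>?W. of_bool (e (fst p) \<union> e (snd p) \<subseteq> M))"
      by (rule sum.swap)
    also have "\<dots> = (\<Sum>p\<in>J \<times> J. ?C * g p)"
    proof (intro sum.cong refl)
      fix p assume "p \<in> J \<times> J"
      then have p: "fst p \<in> J" "snd p \<in> J" by auto
      then have "e (fst p) \<union> e (snd p) \<subseteq> A" "card (e (fst p) \<union> e (snd p)) \<le> m"
        using e cU[OF p] m by auto
      then show "(\<Sum>M\<in>?W. of_bool (e (fst p) \<union> e (snd p) \<subseteq> M)) = ?C * g p"
        using sup[of "e (fst p) \<union> e (snd p)"] unfolding g_def case_prod_beta by blast
    qed
    finally show ?thesis by (simp add: sum_distrib_left)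
  qed
  let ?D = "{(i,j) \<in> J \<times> J. e i \<inter> e j \<noteq> {}}"
  have finJJ: "finite (J \<times> J)" using J by simp
  have "(\<Sum>p\<in>J \<times> J. g p) = (\<Sum>p\<in>?D. g p) + (\<Sum>p\<in>J \<times> J - ?D. g p)"
    using sum.subset_diff[of ?D "J \<times> J" g] finJJ by (auto simp: add.commute)
  also have "(\<Sum>p\<in>J \<times> J - ?D. g p) \<le> (\<Sum>p\<in>J \<times> J - ?D. ?r k * ?r k)"
  proof (rule sum_mono)
    fix p assume "p \<in> J \<times> J - ?D"
    then have p: "fst p \<in> J" "snd p \<in> J" "e (fst p) \<inter> e (snd p) = {}" by auto
    then have "g p = ?r (k + k)" using cU[OF p(1,2)] by (simp add: g_def case_prod_beta mult_2)
    also have "\<dots> \<le> ?r k * ?r k" using m by (intro subset_ratio_add_le) auto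
    finally show "g p \<le> ?r k * ?r k" .
  qed
  also have "\<dots> \<le> (\<Sum>p\<in>J \<times> J. ?r k * ?r k)"
    using finJJ by (intro sum_mono2) auto
  also have "\<dots> = \<mu>\<^sup>2"
    by (simp add: \<mu>(1) power2_eq_square card_cartesian_product algebra_simps)
  finally have S3: "(\<Sum>p\<in>J \<times> J. g p) \<le> (\<Sum>p\<in>?D. g p) + \<mu>\<^sup>2" by simp
  have "(\<Sum>M\<in>?W. (X M - \<mu>)\<^sup>2) = (\<Sum>M\<in>?W. (X M)\<^sup>2 - 2 * \<mu> * X M + \<mu>\<^sup>2)"
    by (intro sum.cong refl) (simp add: power2_diff algebra_simps)
  also have "\<dots> = (\<Sum>M\<in>?W. (X M)\<^sup>2) - 2 * \<mu> * (\<Sum>M\<in>?W. X M) + real (card ?W) * \<mu>\<^sup>2"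
    by (simp add: sum.distrib sum_subtractf sum_distrib_left)
  also have "\<dots> = ?C * ((\<Sum>p\<in>J \<times> J. g p) - \<mu>\<^sup>2)"
    unfolding S1 S2 cW by (simp add: algebra_simps power2_eq_square)
  also have "\<dots> \<le> ?C * (\<Sum>p\<in>?D. g p)"
    using S3 Cpos by (intro mult_left_mono) auto
  finally have var: "(\<Sum>M\<in>?W. (X M - \<mu>)\<^sup>2) \<le> ?C * (\<Sum>p\<in>?D. g p)" .
  let ?B = "{M \<in> ?W. card {i \<in> J. e i \<subseteq> M} \<le> 1}"
  have B: "?B = {M \<in> ?W. X M \<le> 1}" unfolding X by auto
  have "real (card ?B) * (\<mu> - 1)\<^sup>2 \<le> ?C * (\<Sum>p\<in>?D. g p)"
    using card_le_second_moment[OF finW, of \<mu> X] var \<mu>(2) unfolding B by linarith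
  \<comment> \<open>Replacing \<open>\<mu> - 1\<close> by \<open>\<mu> / 2\<close> is the source of
    the factor 4.\<close>
  moreover have "(\<mu> / 2)\<^sup>2 \<le> (\<mu> - 1)\<^sup>2" using \<mu>(2) by (intro power_mono) auto
  then have "real (card ?B) * (\<mu> / 2)\<^sup>2 \<le> real (card ?B) * (\<mu> - 1)\<^sup>2"
    by (intro mult_left_mono) auto
  ultimately have "real (card ?B) * (\<mu> / 2)\<^sup>2 \<le> ?C * (\<Sum>p\<in>?D. g p)" by linarith
  then have "real (card ?B) / ?C \<le> 4 / \<mu>\<^sup>2 * (\<Sum>p\<in>?D. g p)"
    using Cpos \<mu>(2) by (simp add: field_simps power2_eq_square)
  also have "(\<Sum>p\<in>?D. g p) = (\<Sum>(i,j)\<in>?D. ?r (2 * k - card (e i \<inter> e j)))"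
    using cU by (intro sum.cong) (auto simp: g_def)
  finally show ?thesis .
qed


section \<open>First and second moment bounds\<close>

lemma Kn_edges_eq: "Kn_edges n = {e. e \<subseteq> {0..<n} \<and> card e = 2}"
  unfolding Kn_edges_def by (auto simp: card_2_iff) blast

lemma finite_Kn_edges: "finite (Kn_edges n)"
  unfolding Kn_edges_eq by (rule finite_subset[of _ "Pow {0..<n}"]) auto

lemma card_Kn_edges: "card (Kn_edges n) = n choose 2"
  unfolding Kn_edges_eq using n_subsets[of "{0..<n}" 2] by simp

text \<open>No subgraph of the double diamond is denser than the whole. This bounds the edges that
  two copies share by their common vertices; it is checked on all 128 vertex sets.\<close>

lemma edges_in_DD_le:
  assumes "I \<subseteq> {0..<7}"
  shows "7 * card (edges_in DD I) \<le> 10 * card I"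
proof -
  have "card (edges_in DD I) = (\<Sum>e\<in>DD. of_bool (e \<subseteq> I))"
    unfolding edges_in_def by (simp add: of_bool_def sum.If_cases DD_def Int_def)
  also have "\<dots> = of_bool ({0,1} \<subseteq> I) + of_bool ({0,2} \<subseteq> I) + of_bool ({0,3} \<subseteq> I) + of_bool ({1,2} \<subseteq> I)
    + of_bool ({1,3} \<subseteq> I) + of_bool ({0,4} \<subseteq> I) + of_bool ({0,5} \<subseteq> I) + of_bool ({0,6} \<subseteq> I)
    + of_bool ({4,5} \<subseteq> I) + of_bool ({4,6} \<subseteq> I)"
    unfolding DD_def by (simp add: doubleton_eq_iff)
  finally have e: "card (edges_in DD I) = \<dots>" .
  have "card I = (\<Sum>i\<in>{0..<7}. of_bool (i \<in> I))"
    using assms by (simp add: of_bool_def sum.If_cases Int_absorb1)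
  also have "\<dots> = of_bool (0 \<in> I) + of_bool (1 \<in> I) + of_bool (2 \<in> I) + of_bool (3 \<in> I)
      + of_bool (4 \<in> I) + of_bool (5 \<in> I) + of_bool (6 \<in> I)"
    unfolding atLeastLessThan_7 by simp
  finally show ?thesis
    unfolding e
    by (cases "0 \<in> I"; cases "1 \<in> I"; cases "2 \<in> I"; cases "3 \<in> I"; cases "4 \<in> I"; cases "5 \<in> I"; cases "6 \<in> I")
      simp_all
qed

text \<open>Only embeddings sending vertex \<open>i\<close> into the residue class of \<open>i\<close> modulo 7 are counted, so that
  two copies can only meet in corresponding vertices.\<close>

definition DD_emb :: "(nat \<Rightarrow> nat) \<Rightarrow> nat \<Rightarrow> nat" where
  "DD_emb \<kappa> i = 7 * \<kappa> i + i"

definition DD_at :: "(nat \<Rightarrow> nat) \<Rightarrow> nat set set" where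
  "DD_at \<kappa> = (\<lambda>e. DD_emb \<kappa> ` e) ` DD"

section \<open>Overlaps of embedded double diamonds\<close>

lemma DD_emb_eq_iff:
  assumes "i < 7" "j < 7"
  shows "DD_emb \<kappa> i = DD_emb \<kappa>' j \<longleftrightarrow> i = j \<and> \<kappa> i = \<kappa>' j"
proof
  assume *: "DD_emb \<kappa> i = DD_emb \<kappa>' j"
  then have "DD_emb \<kappa> i mod 7 = DD_emb \<kappa>' j mod 7" by simp
  then have "i = j" using assms by (simp add: DD_emb_def)
  then show "i = j \<and> \<kappa> i = \<kappa>' j" using * by (simp add: DD_emb_def)
qed (auto simp: DD_emb_def)

lemma inj_DD_emb: "inj_on (DD_emb \<kappa>) {0..<7}"
  by (rule inj_onI) (simp add: DD_emb_eq_iff)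

lemma DD_edge: "e \<in> DD \<Longrightarrow> e \<subseteq> {0..<7} \<and> card e = 2"
  unfolding DD_def atLeastLessThan_7 by auto

lemma Union_DD_at: "\<Union>(DD_at \<kappa>) = DD_emb \<kappa> ` {0..<7}"
  unfolding DD_at_def Union_DD[symmetric] by blast

lemma card_DD_at: "card (DD_at \<kappa>) = 10"
  unfolding DD_at_def using inj_on_image[of "DD_emb \<kappa>" DD] inj_DD_emb[of \<kappa>]
  by (simp add: card_image card_DD Union_DD)

abbreviation positions :: "nat \<Rightarrow> (nat \<Rightarrow> nat) set" where
  "positions q \<equiv> {0..<7} \<rightarrow>\<^sub>E {0..<q}"

lemma DD_emb_less:
  assumes "\<kappa> \<in> positions q" "7 * q \<le> n"
  shows "DD_emb \<kappa> ` {0..<7} \<subseteq> {0..<n}"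
proof
  fix v assume "v \<in> DD_emb \<kappa> ` {0..<7}"
  then obtain i where i: "i < 7" "v = 7 * \<kappa> i + i" by (auto simp: DD_emb_def)
  then have "\<kappa> i < q" using assms(1) by (auto simp: PiE_def Pi_def)
  then show "v \<in> {0..<n}" using i assms(2) by simp
qed

lemma DD_at_in_copies:
  assumes "\<kappa> \<in> positions q" "7 * q \<le> n" "DD_at \<kappa> \<subseteq> G"
  shows "DD_at \<kappa> \<in> copies n DD G"
  unfolding copies_def DD_at_def Union_DD
  using assms(3) inj_DD_emb DD_emb_less[OF assms(1,2)] unfolding DD_at_def
  by (intro CollectI exI[of _ "DD_emb \<kappa>"]) auto

lemma DD_at_subset_Kn:
  assumes "\<kappa> \<in> positions q" "7 * q \<le> n"
  shows "DD_at \<kappa> \<subseteq> Kn_edges n"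
proof
  fix e assume "e \<in> DD_at \<kappa>"
  then obtain d where d: "d \<in> DD" "e = DD_emb \<kappa> ` d" by (auto simp: DD_at_def)
  have "inj_on (DD_emb \<kappa>) d" using DD_edge[OF d(1)] inj_DD_emb inj_on_subset by blast
  then have "card e = 2" using DD_edge[OF d(1)] d(2) by (simp add: card_image)
  moreover have "e \<subseteq> {0..<n}" using DD_emb_less[OF assms] DD_edge[OF d(1)] d(2) by blast
  ultimately show "e \<in> Kn_edges n" by (simp add: Kn_edges_eq)
qed

text \<open>Residues modulo 7 recover the role of each vertex, so no copy is counted twice despite
  the symmetries of the double diamond.\<close>

lemma inj_DD_at: "inj_on DD_at (positions q)"
proof (rule inj_onI)
  fix \<kappa> \<kappa>' assume k: "\<kappa> \<in> positions q" "\<kappa>' \<in> positions q" "DD_at \<kappa> = DD_at \<kappa>'"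
  have "\<kappa> i = \<kappa>' i" if "i \<in> {0..<7}" for i
  proof -
    have "DD_emb \<kappa> i \<in> DD_emb \<kappa>' ` {0..<7}" using k(3) that Union_DD_at by blast
    then obtain j where "j < 7" "DD_emb \<kappa> i = DD_emb \<kappa>' j" by auto
    then have "i = j \<and> \<kappa> i = \<kappa>' j" using that by (intro DD_emb_eq_iff[THEN iffD1]) auto
    then show ?thesis by auto
  qed
  then show "\<kappa> = \<kappa>'" using k(1,2) by (intro PiE_ext)
qed

lemma card_DD_at_Int:
  "card (DD_at \<kappa> \<inter> DD_at \<kappa>') \<le> card (edges_in DD {i \<in> {0..<7}. \<kappa> i = \<kappa>' i})"
proof -
  let ?I = "{i \<in> {0..<7}. \<kappa> i = \<kappa>' i}"
  have "DD_at \<kappa> \<inter> DD_at \<kappa>' \<subseteq> (\<lambda>e. DD_emb \<kappa> ` e) ` edges_in DD ?I"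
  proof
    fix e assume "e \<in> DD_at \<kappa> \<inter> DD_at \<kappa>'"
    then obtain d d' where d: "d \<in> DD" "e = DD_emb \<kappa> ` d" "d' \<in> DD" "e = DD_emb \<kappa>' ` d'"
      by (auto simp: DD_at_def)
    have "i \<in> ?I" if "i \<in> d" for i
    proof -
      have "DD_emb \<kappa> i \<in> DD_emb \<kappa>' ` d'" using that d by blast
      then obtain j where "j \<in> d'" "DD_emb \<kappa> i = DD_emb \<kappa>' j" by blast
      moreover have "i < 7" "j < 7"
        using DD_edge[OF d(1)] DD_edge[OF d(3)] that \<open>j \<in> d'\<close> by auto
      ultimately show ?thesis using DD_emb_eq_iff[of i j \<kappa> \<kappa>'] by auto
    qed
    then have "d \<in> edges_in DD ?I" using d(1) by (auto simp: edges_in_def)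
    then show "e \<in> (\<lambda>e. DD_emb \<kappa> ` e) ` edges_in DD ?I" using d(2) by blast
  qed
  then have "card (DD_at \<kappa> \<inter> DD_at \<kappa>') \<le> card ((\<lambda>e. DD_emb \<kappa> ` e) ` edges_in DD ?I)"
    by (intro card_mono finite_imageI finite_edges_in) auto
  also have "\<dots> \<le> card (edges_in DD ?I)"
    by (intro card_image_le finite_edges_in) auto
  finally show ?thesis .
qed

lemma finite_positions: "finite (positions q)"
  by (intro finite_PiE) auto

lemma card_positions: "card (positions q) = q ^ 7"
  by (simp add: card_PiE)

text \<open>On \<open>I\<close> the second position is dictated by the first, so only its values
  outside \<open>I\<close> are free.\<close>

lemma card_agreeing_positions:
  assumes "I \<subseteq> {0..<7}"
  shows "card {(\<kappa>,\<kappa>') \<in> positions q \<times> positions q. {i \<in> {0..<7}. \<kappa> i = \<kappa>' i} = I} \<le> q ^ (14 - card I)"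
proof -
  let ?P = "{(\<kappa>,\<kappa>') \<in> positions q \<times> positions q. {i \<in> {0..<7}. \<kappa> i = \<kappa>' i} = I}"
  let ?T = "positions q \<times> (({0..<7} - I) \<rightarrow>\<^sub>E {0..<q})"
  let ?f = "\<lambda>(\<kappa>::nat\<Rightarrow>nat, \<kappa>'::nat\<Rightarrow>nat). (\<kappa>, restrict \<kappa>' ({0..<7} - I))"
  have finI: "finite I" using assms finite_subset by blast
  have "inj_on ?f ?P"
  proof (rule inj_onI)
    fix x y assume x: "x \<in> ?P" and y: "y \<in> ?P" and xy: "?f x = ?f y"
    obtain \<kappa> \<kappa>1 \<kappa>' \<kappa>1' where [simp]: "x = (\<kappa>, \<kappa>1)" "y = (\<kappa>', \<kappa>1')"
      by (cases x, cases y)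
    have P: "\<kappa>1 \<in> positions q" "\<kappa>1' \<in> positions q"
      and I: "{i \<in> {0..<7}. \<kappa> i = \<kappa>1 i} = I" "{i \<in> {0..<7}. \<kappa>' i = \<kappa>1' i} = I"
      and eq: "\<kappa> = \<kappa>'" "restrict \<kappa>1 ({0..<7} - I) = restrict \<kappa>1' ({0..<7} - I)"
      using x y xy by simp_all
    have "\<kappa>1 i = \<kappa>1' i" if i: "i \<in> {0..<7}" for i
    proof (cases "i \<in> I")
      case True
      then have "\<kappa> i = \<kappa>1 i" "\<kappa>' i = \<kappa>1' i" using I by blast+
      then show ?thesis using eq(1) by simp
    next
      case False
      then show ?thesis using fun_cong[OF eq(2), of i] i by (simp add: restrict_def)
    qed
    then have "\<kappa>1 = \<kappa>1'" using P by (intro PiE_ext)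
    then show "x = y" using eq(1) by simp
  qed
  moreover have "?f ` ?P \<subseteq> ?T" by (auto simp: restrict_PiE_iff PiE_def Pi_def)
  moreover have "finite ?T" by (intro finite_cartesian_product finite_PiE) auto
  ultimately have "card ?P \<le> card ?T" by (rule card_inj_on_le)
  also have "\<dots> = q ^ 7 * q ^ (7 - card I)"
    using assms finI by (simp add: card_cartesian_product card_PiE card_Diff_subset)
  also have "\<dots> = q ^ (14 - card I)"
    using card_mono[OF _ assms] by (simp add: power_add[symmetric])
  finally show ?thesis .
qed

text \<open>Pairs of copies with a common edge are grouped by the nonempty set \<open>I\<close>
  where their positions agree: there are at most q^(14 - |I|) of them, each with probability at most
  p^(20 - 10 |I| div 7). Dividing by the square of the mean, at least (q^7 (p/2)^10)^2, leaves the
  summand; 2^22 is 4 times 2^20.\<close>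

lemma few_DD_bound:
  fixes n q m :: nat
  defines "p \<equiv> real m / real (n choose 2)"
  assumes q: "7 * q \<le> n" "0 < q" and m: "20 \<le> m" "m \<le> n choose 2"
    and big: "2 \<le> real q ^ 7 * (p / 2) ^ 10"
  shows "real (card {M \<in> subsets_of_size (Kn_edges n) m. \<not> has_k_copies n 2 DD M}) / real ((n choose 2) choose m)
    \<le> 2 ^ 22 * (\<Sum>I\<in>Pow {0..<7::nat} - {{}}. 1 / (real q ^ card I * p ^ (10 * card I div 7)))"
proof -
  let ?A = "Kn_edges n" and ?J = "positions q"
  let ?r = "subset_ratio (card ?A) m"
  define \<mu> where "\<mu> = real (card ?J) * ?r 10"
  have "real m \<le> real (n choose 2)" "0 < real m" using m by simp_all
  then have "0 < real (n choose 2)" by linarith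
  have p: "0 < p" unfolding p_def by (rule divide_pos_pos) fact+
  have p1: "p \<le> 1"
    unfolding p_def using \<open>real m \<le> real (n choose 2)\<close> \<open>0 < real (n choose 2)\<close>
    by (simp only: divide_le_eq_1_pos)
  have mu: "real q ^ 7 * (p / 2) ^ 10 \<le> \<mu>"
    unfolding \<mu>_def card_positions p_def using m subset_ratio_ge_power[of 10 m "card ?A"]
    by (intro mult_mono) (auto simp: card_Kn_edges)
  let ?agree = "\<lambda>(\<kappa>::nat\<Rightarrow>nat, \<kappa>'::nat\<Rightarrow>nat). {i \<in> {0..<7::nat}. \<kappa> i = \<kappa>' i}"
  let ?D = "{(\<kappa>,\<kappa>') \<in> ?J \<times> ?J. DD_at \<kappa> \<inter> DD_at \<kappa>' \<noteq> {}}"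
  let ?P = "Pow {0..<7::nat} - {{}}"
  have finD: "finite ?D"
    by (rule finite_subset[of _ "?J \<times> ?J"]) (auto intro!: finite_cartesian_product finite_positions)
  have ratio_le: "?r (2 * 10 - card (DD_at \<kappa> \<inter> DD_at \<kappa>')) \<le> p ^ (20 - 10 * card (?agree (\<kappa>,\<kappa>')) div 7)" for \<kappa> \<kappa>'
  proof -
    let ?c = "card (DD_at \<kappa> \<inter> DD_at \<kappa>')" and ?I = "{i \<in> {0..<7::nat}. \<kappa> i = \<kappa>' i}"
    have "7 * ?c \<le> 10 * card ?I"
      using card_DD_at_Int[of \<kappa> \<kappa>'] edges_in_DD_le[of ?I] by (simp add: subset_eq)
    then have "?c \<le> 10 * card ?I div 7" by (simp add: less_eq_div_iff_mult_less_eq mult.commute)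
    have "?r (2 * 10 - ?c) \<le> p ^ (2 * 10 - ?c)"
      unfolding p_def using m subset_ratio_le_power[of "2 * 10 - ?c" m "card ?A"] by (simp add: card_Kn_edges)
    also have "\<dots> \<le> p ^ (20 - 10 * card ?I div 7)"
      using p p1 \<open>?c \<le> 10 * card ?I div 7\<close> by (intro power_decreasing) auto
    finally show ?thesis by simp
  qed
  have agree: "?agree ` ?D \<subseteq> ?P"
  proof
    fix I assume "I \<in> ?agree ` ?D"
    then obtain \<kappa> \<kappa>' where k: "DD_at \<kappa> \<inter> DD_at \<kappa>' \<noteq> {}" "I = {i \<in> {0..<7::nat}. \<kappa> i = \<kappa>' i}" by auto
    have "finite (DD_at \<kappa> \<inter> DD_at \<kappa>')" using card_DD_at[of \<kappa>] by (metis card.infinite finite_Int zero_neq_numeral)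
    then have "0 < card (DD_at \<kappa> \<inter> DD_at \<kappa>')" using k(1) by (simp add: card_gt_0_iff)
    then have "0 < card (edges_in DD I)" using card_DD_at_Int[of \<kappa> \<kappa>'] k(2) by simp
    then have "edges_in DD I \<noteq> {}" by auto
    then obtain e where "e \<in> DD" "e \<subseteq> I" by (auto simp: edges_in_def)
    then have "I \<noteq> {}" using DD_edge[of e] by auto
    then show "I \<in> ?P" using k(2) by auto
  qed
  have "(\<Sum>(\<kappa>,\<kappa>')\<in>?D. ?r (2 * 10 - card (DD_at \<kappa> \<inter> DD_at \<kappa>'))) \<le> (\<Sum>x\<in>?D. p ^ (20 - 10 * card (?agree x) div 7))"
    using ratio_le by (intro sum_mono) (auto split: prod.split)
  also have "\<dots> = (\<Sum>I\<in>?P. \<Sum>x\<in>{x \<in> ?D. ?agree x = I}. p ^ (20 - 10 * card (?agree x) div 7))"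
    using sum.group[OF finD _ agree, of "\<lambda>x. p ^ (20 - 10 * card (?agree x) div 7)"] by simp
  also have "\<dots> \<le> (\<Sum>I\<in>?P. real q ^ (14 - card I) * p ^ (20 - 10 * card I div 7))"
  proof (rule sum_mono)
    fix I assume I: "I \<in> ?P"
    let ?Q = "{(\<kappa>,\<kappa>') \<in> ?J \<times> ?J. {i \<in> {0..<7}. \<kappa> i = \<kappa>' i} = I}"
    have "finite ?Q"
      by (rule finite_subset[of _ "?J \<times> ?J"]) (auto intro!: finite_cartesian_product finite_positions)
    then have "card {x \<in> ?D. ?agree x = I} \<le> card ?Q" by (intro card_mono) auto
    also have "\<dots> \<le> q ^ (14 - card I)" using I by (intro card_agreeing_positions) auto
    finally have "real (card {x \<in> ?D. ?agree x = I}) \<le> real (q ^ (14 - card I))"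
      by (simp only: of_nat_le_iff)
    then have "real (card {x \<in> ?D. ?agree x = I}) \<le> real q ^ (14 - card I)"
      by (simp only: of_nat_power)
    moreover have "(\<Sum>x\<in>{x \<in> ?D. ?agree x = I}. p ^ (20 - 10 * card (?agree x) div 7)) =
        real (card {x \<in> ?D. ?agree x = I}) * p ^ (20 - 10 * card I div 7)"
      by simp
    ultimately show "(\<Sum>x\<in>{x \<in> ?D. ?agree x = I}. p ^ (20 - 10 * card (?agree x) div 7)) \<le>
        real q ^ (14 - card I) * p ^ (20 - 10 * card I div 7)"
      using p by (simp only:) (intro mult_right_mono, auto)
  qed
  also have "\<dots> = (\<Sum>I\<in>?P. real q ^ 14 * p ^ 20 * (1 / (real q ^ card I * p ^ (10 * card I div 7))))"
  proof (intro sum.cong refl)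
    fix I assume "I \<in> ?P"
    then have "card I \<le> 7" using card_mono[of "{0..<7}" I] by auto
    then have "card I \<le> 14" "10 * card I div 7 \<le> 20" by auto
    then show "real q ^ (14 - card I) * p ^ (20 - 10 * card I div 7) =
        real q ^ 14 * p ^ 20 * (1 / (real q ^ card I * p ^ (10 * card I div 7)))"
      using p q(2) by (simp add: power_diff)
  qed
  also have "\<dots> = real q ^ 14 * p ^ 20 * (\<Sum>I\<in>?P. 1 / (real q ^ card I * p ^ (10 * card I div 7)))"
    by (simp add: sum_distrib_left)
  finally have S: "(\<Sum>(\<kappa>,\<kappa>')\<in>?D. ?r (2 * 10 - card (DD_at \<kappa> \<inter> DD_at \<kappa>'))) \<le>
      real q ^ 14 * p ^ 20 * (\<Sum>I\<in>?P. 1 / (real q ^ card I * p ^ (10 * card I div 7)))" (is "_ \<le> ?q * ?s") .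
  have s0: "0 \<le> ?s" using p by (intro sum_nonneg) auto
  have "{M \<in> subsets_of_size ?A m. \<not> has_k_copies n 2 DD M} \<subseteq>
      {M \<in> subsets_of_size ?A m. card {\<kappa> \<in> ?J. DD_at \<kappa> \<subseteq> M} \<le> 1}"
  proof clarify
    fix M assume M: "\<not> has_k_copies n 2 DD M"
    show "card {\<kappa> \<in> ?J. DD_at \<kappa> \<subseteq> M} \<le> 1"
    proof (rule ccontr)
      assume "\<not> ?thesis"
      moreover have "finite {\<kappa> \<in> ?J. DD_at \<kappa> \<subseteq> M}" using finite_positions by simp
      ultimately have "\<not> (\<forall>\<kappa>\<in>{\<kappa> \<in> ?J. DD_at \<kappa> \<subseteq> M}. \<forall>\<kappa>'\<in>{\<kappa> \<in> ?J. DD_at \<kappa> \<subseteq> M}. \<kappa> = \<kappa>')"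
        by (simp only: card_le_Suc0_iff_eq One_nat_def not_False_eq_True)
      then obtain \<kappa> \<kappa>' where k: "\<kappa> \<in> ?J" "\<kappa>' \<in> ?J" "DD_at \<kappa> \<subseteq> M" "DD_at \<kappa>' \<subseteq> M" "\<kappa> \<noteq> \<kappa>'"
        by blast
      then have "DD_at \<kappa> \<noteq> DD_at \<kappa>'" using inj_onD[OF inj_DD_at] by blast
      moreover have "DD_at \<kappa> \<in> copies n DD M" "DD_at \<kappa>' \<in> copies n DD M"
        using DD_at_in_copies[OF k(1) q(1) k(3)] DD_at_in_copies[OF k(2) q(1) k(4)] .
      ultimately have "has_k_copies n 2 DD M" unfolding has_k_copies_2 by (intro bexI)
      with M show False by simp
    qed
  qed
  then have "card {M \<in> subsets_of_size ?A m. \<not> has_k_copies n 2 DD M} \<le>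
      card {M \<in> subsets_of_size ?A m. card {\<kappa> \<in> ?J. DD_at \<kappa> \<subseteq> M} \<le> 1}"
    using finite_subsets_of_size[OF finite_Kn_edges] by (intro card_mono) auto
  then have "real (card {M \<in> subsets_of_size ?A m. \<not> has_k_copies n 2 DD M}) / real (card ?A choose m) \<le>
      real (card {M \<in> subsets_of_size ?A m. card {\<kappa> \<in> ?J. DD_at \<kappa> \<subseteq> M} \<le> 1}) / real (card ?A choose m)"
    by (intro divide_right_mono) auto
  also have "\<dots> \<le> 4 / \<mu>\<^sup>2 * (\<Sum>(\<kappa>,\<kappa>')\<in>?D. ?r (2 * 10 - card (DD_at \<kappa> \<inter> DD_at \<kappa>')))"
    using m mu big DD_at_subset_Kn[OF _ q(1)]
    by (intro second_moment_family finite_Kn_edges finite_positions)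
       (auto simp: card_DD_at card_Kn_edges \<mu>_def)
  also have "\<dots> \<le> 4 / \<mu>\<^sup>2 * (?q * ?s)"
    using S by (intro mult_left_mono) auto
  also have "\<dots> \<le> 4 / (real q ^ 7 * (p / 2) ^ 10)\<^sup>2 * (?q * ?s)"
    using mu big s0 p q(2) by (intro mult_right_mono divide_left_mono power_mono mult_pos_pos zero_less_power) auto
  also have "\<dots> = 2 ^ 22 * ?s"
    using p q(2) by (simp add: power_divide power_mult_distrib field_simps flip: power_mult)
  finally show ?thesis by (simp add: card_Kn_edges)
qed

text \<open>A union bound over the size \<open>s\<close>, the vertex set \<open>S\<close> and the
  set \<open>K\<close> of edges inside, where \<open>10 * s div 7 + 1\<close> is the least number of
  edges that makes the excess negative. At s = 30 it equals 43. The crude count 2^(2^s) for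
  \<open>K\<close> is a constant since s is bounded.\<close>

lemma not_sparse_bound:
  fixes n m :: nat
  assumes m: "43 \<le> m" "m \<le> n choose 2"
  shows "real (card {M \<in> subsets_of_size (Kn_edges n) m. \<not> locally_sparse M}) / real ((n choose 2) choose m)
    \<le> (\<Sum>s\<le>30. 2 ^ (2 ^ s) * (real n ^ s * (real m / real (n choose 2)) ^ (10 * s div 7 + 1)))"
proof -
  let ?A = "Kn_edges n" and ?k = "\<lambda>s::nat. 10 * s div 7 + 1"
  let ?W = "subsets_of_size ?A m" and ?C = "real ((n choose 2) choose m)"
  let ?K = "\<lambda>S. {K \<in> Pow (Pow S). K \<subseteq> ?A \<and> card K = ?k (card S)}"
  let ?S = "\<lambda>s. subsets_of_size {0..<n} s"
  have "{M \<in> ?W. \<not> locally_sparse M} \<subseteq> (\<Union>s\<in>{..30}. \<Union>S\<in>?S s. \<Union>K\<in>?K S. {M \<in> ?W. K \<subseteq> M})"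
  proof clarify
    fix M assume M: "M \<in> ?W" "\<not> locally_sparse M"
    then obtain S0 where S0: "finite S0" "card S0 \<le> 30" "excess M S0 < 0"
      by (auto simp: locally_sparse_def not_le)
    \<comment> \<open>Vertices outside [n] carry no edges and only raise the excess, so they can be
      discarded.\<close>
    let ?S = "S0 \<inter> {0..<n}"
    have MA: "M \<subseteq> ?A" using M by (simp add: subsets_of_size_def)
    have "edges_in M S0 = edges_in M ?S"
      using MA unfolding edges_in_def Kn_edges_eq by blast
    moreover have cS: "card ?S \<le> card S0" using S0(1) by (intro card_mono) auto
    ultimately have "10 * card ?S < 7 * card (edges_in M ?S)"
      using S0(3) unfolding excess_def by simp
    then have "?k (card ?S) \<le> card (edges_in M ?S)" by linarith
    then obtain K where K: "K \<subseteq> edges_in M ?S" "card K = ?k (card ?S)"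
      using obtain_subset_with_card_n by metis
    then have "K \<subseteq> M" "K \<subseteq> Pow ?S" by (auto simp: edges_in_def)
    then show "M \<in> (\<Union>s\<in>{..30}. \<Union>S\<in>subsets_of_size {0..<n} s. \<Union>K\<in>?K S. {M \<in> ?W. K \<subseteq> M})"
      using K(2) MA M(1) cS S0(2)
      by (intro UN_I[of "card ?S"] UN_I[of ?S] UN_I[of K]) (auto simp: subsets_of_size_def)
  qed
  then have "card {M \<in> ?W. \<not> locally_sparse M} \<le> card (\<Union>s\<in>{..30}. \<Union>S\<in>?S s. \<Union>K\<in>?K S. {M \<in> ?W. K \<subseteq> M})"
    by (rule card_mono[rotated]) (rule finite_subset[of _ ?W], auto simp: finite_subsets_of_size finite_Kn_edges)
  also have "\<dots> \<le> (\<Sum>s\<le>30. card (\<Union>S\<in>?S s. \<Union>K\<in>?K S. {M \<in> ?W. K \<subseteq> M}))"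
    by (rule card_UN_le) auto
  also have "\<dots> \<le> (\<Sum>s\<le>30. \<Sum>S\<in>?S s. card (\<Union>K\<in>?K S. {M \<in> ?W. K \<subseteq> M}))"
    by (intro sum_mono card_UN_le finite_subsets_of_size) auto
  also have "\<dots> \<le> (\<Sum>s\<le>30. \<Sum>S\<in>?S s. \<Sum>K\<in>?K S. card {M \<in> ?W. K \<subseteq> M})"
  proof (intro sum_mono card_UN_le)
    fix s S assume "S \<in> ?S s"
    then have "finite S" using finite_subset[of S "{0..<n}"] by (auto simp: subsets_of_size_def)
    then show "finite (?K S)" by simp
  qed
  finally have "real (card {M \<in> ?W. \<not> locally_sparse M}) \<le> real (\<Sum>s\<le>30. \<Sum>S\<in>?S s. \<Sum>K\<in>?K S. card {M \<in> ?W. K \<subseteq> M})"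
    by (simp only: of_nat_le_iff)
  also have "\<dots> = (\<Sum>s\<le>30. \<Sum>S\<in>?S s. \<Sum>K\<in>?K S. real (card {M \<in> ?W. K \<subseteq> M}))"
    by simp
  also have "\<dots> \<le> (\<Sum>s\<le>30. ?C * (2 ^ (2 ^ s) * (real n ^ s * (real m / real (n choose 2)) ^ ?k s)))"
  proof (rule sum_mono)
    fix s :: nat assume s: "s \<in> {..30}"
    let ?p = "(real m / real (n choose 2)) ^ ?k s"
    have "(\<Sum>K\<in>?K S. real (card {M \<in> ?W. K \<subseteq> M})) \<le> 2 ^ (2 ^ s) * (?C * ?p)" if S: "S \<in> ?S s" for S
    proof -
      have cS: "card S = s" "finite S" using S finite_subset[of S "{0..<n}"] by (auto simp: subsets_of_size_def)
      have "(\<Sum>K\<in>?K S. real (card {M \<in> ?W. K \<subseteq> M})) \<le> (\<Sum>K\<in>?K S. ?C * ?p)"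
      proof (rule sum_mono)
        fix K assume K: "K \<in> ?K S"
        have km: "?k s \<le> m" using s m by auto
        have "real (card {M \<in> ?W. K \<subseteq> M}) = ?C * subset_ratio (n choose 2) m (?k s)"
          using card_supersets_of_size[of ?A K m] K km m cS finite_Kn_edges[of n] by (simp add: card_Kn_edges)
        also have "\<dots> \<le> ?C * ?p" using subset_ratio_le_power[OF km m(2)] by (intro mult_left_mono) auto
        finally show "real (card {M \<in> ?W. K \<subseteq> M}) \<le> ?C * ?p" .
      qed
      also have "\<dots> = real (card (?K S)) * (?C * ?p)" by simp
      also have "\<dots> \<le> 2 ^ (2 ^ s) * (?C * ?p)"
      proof (rule mult_right_mono)
        have "card (?K S) \<le> card (Pow (Pow S))" using cS by (intro card_mono) auto
        also have "\<dots> = 2 ^ (2 ^ s)" using cS by (simp add: card_Pow)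
        finally have "real (card (?K S)) \<le> real (2 ^ (2 ^ s))" by (simp only: of_nat_le_iff)
        then show "real (card (?K S)) \<le> 2 ^ (2 ^ s)" by simp
      qed auto
      finally show ?thesis .
    qed
    then have "(\<Sum>S\<in>?S s. \<Sum>K\<in>?K S. real (card {M \<in> ?W. K \<subseteq> M})) \<le> (\<Sum>S\<in>?S s. 2 ^ (2 ^ s) * (?C * ?p))"
      by (rule sum_mono)
    also have "\<dots> = real (n choose s) * (2 ^ (2 ^ s) * (?C * ?p))"
      by (simp add: card_subsets_of_size)
    also have "\<dots> \<le> real n ^ s * (2 ^ (2 ^ s) * (?C * ?p))"
    proof (rule mult_right_mono)
      have "n choose s \<le> n ^ s" by (cases "s \<le> n") (auto intro: binomial_le_pow simp: binomial_eq_0)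
      then show "real (n choose s) \<le> real n ^ s" by (metis of_nat_le_iff of_nat_power)
    qed auto
    finally show "(\<Sum>S\<in>?S s. \<Sum>K\<in>?K S. real (card {M \<in> ?W. K \<subseteq> M})) \<le>
        ?C * (2 ^ (2 ^ s) * (real n ^ s * ?p))" by (simp add: mult_ac)
  qed
  also have "\<dots> = ?C * (\<Sum>s\<le>30. 2 ^ (2 ^ s) * (real n ^ s * (real m / real (n choose 2)) ^ ?k s))"
    by (rule sum_distrib_left[symmetric])
  finally have le: "real (card {M \<in> ?W. \<not> locally_sparse M}) \<le>
      ?C * (\<Sum>s\<le>30. 2 ^ (2 ^ s) * (real n ^ s * (real m / real (n choose 2)) ^ ?k s))" .
  have "0 < ?C" using m(2) by simp
  then show ?thesis using le by (simp only: pos_divide_le_eq mult.commute)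
qed


section \<open>Asymptotics\<close>

lemma real_choose_2: "real (n choose 2) = real n * (real n - 1) / 2"
  by (induction n) (simp_all add: numeral_2_eq_2 field_simps)

text \<open>Slightly above the threshold \<open>n\<^bsup>13/10\<^esup>\<close> for the appearance of the double diamond, yet so close to it
  that no set of at most 30 vertices has negative excess.\<close>

definition edge_count :: "nat \<Rightarrow> nat" where
  "edge_count n = nat \<lfloor>real n powr (1301/1000)\<rfloor>"

definition edge_density :: "nat \<Rightarrow> real" where
  "edge_density n = real (edge_count n) / real (n choose 2)"

lemma edge_count_bounds:
  "real (edge_count n) \<le> real n powr (1301/1000)" "real n powr (1301/1000) - 1 \<le> real (edge_count n)"
proof -
  have "0 \<le> \<lfloor>real n powr (1301/1000)\<rfloor>" by simp
  then have "real (edge_count n) = real_of_int \<lfloor>real n powr (1301/1000)\<rfloor>"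
    unfolding edge_count_def by (rule of_nat_nat)
  then show "real (edge_count n) \<le> real n powr (1301/1000)" "real n powr (1301/1000) - 1 \<le> real (edge_count n)"
    by linarith+
qed

lemma eventually_edge_count: "eventually (\<lambda>n. 43 \<le> edge_count n \<and> edge_count n \<le> n choose 2) sequentially"
proof -
  have "eventually (\<lambda>n. 43 \<le> real n powr (1301/1000) - 1) sequentially"
    by real_asymp
  moreover have "eventually (\<lambda>n. real n powr (1301/1000) \<le> real n * (real n - 1) / 2) sequentially"
    by real_asymp
  ultimately show ?thesis
  proof eventually_elim
    case (elim n)
    then have "43 \<le> real (edge_count n)" "real (edge_count n) \<le> real (n choose 2)"
      using edge_count_bounds[of n] real_choose_2[of n] by linarith+
    then show ?case by simp
  qed
qed

text \<open>The density is asymptotically 2 n^(-699/1000); the constants 1 and 4 merely enclose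
  2.\<close>

lemma eventually_edge_density:
  "eventually (\<lambda>n. edge_density n \<le> 4 * real n powr (-699/1000) \<and> real n powr (-699/1000) \<le> edge_density n) sequentially"
proof -
  have "eventually (\<lambda>n. real n powr (1301/1000) / (real n * (real n - 1) / 2) \<le> 4 * real n powr (-699/1000)) sequentially"
    by real_asymp
  moreover have "eventually (\<lambda>n. real n powr (-699/1000) \<le> (real n powr (1301/1000) - 1) / (real n * (real n - 1) / 2)) sequentially"
    by real_asymp
  ultimately show ?thesis
  proof eventually_elim
    case (elim n)
    have "edge_density n \<le> real n powr (1301/1000) / real (n choose 2)"
      "(real n powr (1301/1000) - 1) / real (n choose 2) \<le> edge_density n"
      unfolding edge_density_def using edge_count_bounds[of n] by (intro divide_right_mono; simp)+
    then show ?case using elim real_choose_2[of n] by simp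
  qed
qed

lemma powr_sequence_tendsto_0: "a < 0 \<Longrightarrow> (\<lambda>n. c * real n powr a) \<longlonglongrightarrow> 0"
  using tendsto_mult_right_zero[OF tendsto_neg_powr[OF _ filterlim_real_sequentially]] by blast

text \<open>Negative excess is at most -1 by integrality, so s - 0.7 k is at most -0.1. Passing from
  0.7 to 0.699 adds 0.001 k, which is at most 0.043 because k is at most 43. This is how the
  exponent 1301/1000 and the size bound 30 fit together.\<close>

lemma not_sparse_bound_tendsto_0:
  "(\<lambda>n. \<Sum>s\<le>30. 2 ^ (2 ^ s) * (real n ^ s * edge_density n ^ (10 * s div 7 + 1))) \<longlonglongrightarrow> 0"
proof -
  have "(\<lambda>n. 2 ^ (2 ^ s) * (real n ^ s * edge_density n ^ (10 * s div 7 + 1))) \<longlonglongrightarrow> 0" if s: "s \<le> 30" for s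
  proof -
    define k where "k = 10 * s div 7 + 1"
    have "10 * s + 1 \<le> 7 * k" unfolding k_def by presburger
    then have "10 * real s + 1 \<le> 7 * real k" by linarith
    then have neg: "real s - 699/1000 * real k < 0" using s by linarith
    have "(\<lambda>n. real n ^ s * edge_density n ^ k) \<longlonglongrightarrow> 0"
    proof (rule tendsto_sandwich[OF _ _ tendsto_const powr_sequence_tendsto_0[OF neg, of "4 ^ k"]])
      show "eventually (\<lambda>n. 0 \<le> real n ^ s * edge_density n ^ k) sequentially"
        by (simp add: edge_density_def)
      show "eventually (\<lambda>n. real n ^ s * edge_density n ^ k \<le> 4 ^ k * real n powr (real s - 699/1000 * real k)) sequentially"
        using eventually_edge_density eventually_gt_at_top[of 0]
      proof eventually_elim
        case (elim n)
        have "real n ^ s * edge_density n ^ k \<le> real n ^ s * (4 * real n powr (-699/1000)) ^ k"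
          using elim by (intro mult_left_mono power_mono) (auto simp: edge_density_def)
        also have "\<dots> = 4 ^ k * (real n powr real s * (real n powr (-699/1000)) powr real k)"
          using elim by (simp add: power_mult_distrib powr_realpow mult_ac)
        also have "\<dots> = 4 ^ k * real n powr (real s - 699/1000 * real k)"
          by (simp add: powr_powr flip: powr_add)
        finally show ?case .
      qed
    qed
    then show ?thesis unfolding k_def by (rule tendsto_mult_right_zero)
  qed
  then show ?thesis by (intro tendsto_null_sum) auto
qed

text \<open>Agreeing in i > 0 vertices saves at most 10 i / 7 edges, a gain of order n^(6.99 i / 7)
  against a loss of order n^i. That 6.99 is below 7 is where the edge count lies above the
  threshold.\<close>

lemma few_DD_bound_tendsto_0:
  "(\<lambda>n. 2 ^ 22 * (\<Sum>I\<in>Pow {0..<7::nat} - {{}}.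
      1 / (real (n div 7) ^ card I * edge_density n ^ (10 * card I div 7)))) \<longlonglongrightarrow> 0"
proof -
  have "(\<lambda>n. 1 / (real (n div 7) ^ card I * edge_density n ^ (10 * card I div 7))) \<longlonglongrightarrow> 0"
    if I: "I \<in> Pow {0..<7::nat} - {{}}" for I
  proof -
    let ?i = "card I" and ?j = "10 * card I div 7"
    have "finite I" using I finite_subset by blast
    then have "0 < ?i" using I by (simp add: card_gt_0_iff)
    moreover have "7 * ?j \<le> 10 * ?i" by presburger
    ultimately have neg: "699/1000 * real ?j - real ?i < 0" by linarith
    show ?thesis
    proof (rule tendsto_sandwich[OF _ _ tendsto_const powr_sequence_tendsto_0[OF neg, of "14 ^ ?i"]])
      show "eventually (\<lambda>n. 0 \<le> 1 / (real (n div 7) ^ ?i * edge_density n ^ ?j)) sequentially"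
        by (simp add: edge_density_def)
      show "eventually (\<lambda>n. 1 / (real (n div 7) ^ ?i * edge_density n ^ ?j) \<le>
          14 ^ ?i * real n powr (699/1000 * real ?j - real ?i)) sequentially"
        using eventually_edge_density eventually_ge_at_top[of 14]
      proof eventually_elim
        case (elim n)
        have "n \<le> 14 * (n div 7)" using elim by presburger
        then have "real n / 14 \<le> real (n div 7)" by linarith
        then have "(real n / 14) ^ ?i * (real n powr (-699/1000)) ^ ?j \<le> real (n div 7) ^ ?i * edge_density n ^ ?j"
          using elim by (intro mult_mono power_mono) (auto simp: edge_density_def)
        then have "1 / (real (n div 7) ^ ?i * edge_density n ^ ?j) \<le> 1 / ((real n / 14) ^ ?i * (real n powr (-699/1000)) ^ ?j)"
          using elim by (intro divide_left_mono mult_pos_pos) (auto intro!: mult_pos_pos zero_less_power elim: order.strict_trans2[rotated])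
        also have "\<dots> = 14 ^ ?i * (1 / (real n powr real ?i * (real n powr (-699/1000)) powr real ?j))"
          using elim by (simp add: power_divide powr_realpow)
        also have "\<dots> = 14 ^ ?i * real n powr (699/1000 * real ?j - real ?i)"
        proof -
          have "real n powr (699/1000 * real ?j - real ?i) * (real n powr real ?i * (real n powr (-699/1000)) powr real ?j) = 1"
            using elim by (simp add: powr_powr flip: powr_add)
          then show ?thesis using elim by (simp add: field_simps)
        qed
        finally show ?case .
      qed
    qed
  qed
  then show ?thesis by (intro tendsto_mult_right_zero tendsto_null_sum) auto
qed

text \<open>The mean is of order n^(7 - 6.99) = n^(1/100): it tends to infinity, though
  slowly.\<close>

lemma eventually_many_DD: "eventually (\<lambda>n. 2 \<le> real (n div 7) ^ 7 * (edge_density n / 2) ^ 10) sequentially"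
proof -
  have "eventually (\<lambda>n. 2 \<le> (real n / 14) ^ 7 * (real n powr (-699/1000) / 2) ^ 10) sequentially"
    by real_asymp
  then show ?thesis
    using eventually_edge_density eventually_ge_at_top[of 14]
  proof eventually_elim
    case (elim n)
    have "n \<le> 14 * (n div 7)" using elim by presburger
    then have "real n / 14 \<le> real (n div 7)" by linarith
    then have "(real n / 14) ^ 7 * (real n powr (-699/1000) / 2) ^ 10 \<le> real (n div 7) ^ 7 * (edge_density n / 2) ^ 10"
      using elim by (intro mult_mono power_mono) (auto simp: edge_density_def)
    then show ?case using elim by linarith
  qed
qed

section \<open>Bad graphs are unlikely\<close>

definition bad_graph :: "nat \<Rightarrow> nat set set \<Rightarrow> bool" where
  "bad_graph n G \<longleftrightarrow> \<not> locally_sparse G \<or> \<not> has_k_copies n 2 DD G"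

lemma prob_bad_graph_tendsto_0:
  "(\<lambda>n. measure_pmf.prob (random_graph_process n) {xs. bad_graph n (process_graph xs (edge_count n))}) \<longlonglongrightarrow> 0"
proof (rule tendsto_sandwich[OF _ _ tendsto_const
    tendsto_add_zero[OF not_sparse_bound_tendsto_0 few_DD_bound_tendsto_0]])
  let ?b1 = "\<lambda>n. \<Sum>s\<le>30. 2 ^ (2 ^ s) * (real n ^ s * edge_density n ^ (10 * s div 7 + 1))"
  let ?b2 = "\<lambda>n. 2 ^ 22 * (\<Sum>I\<in>Pow {0..<7::nat} - {{}}.
      1 / (real (n div 7) ^ card I * edge_density n ^ (10 * card I div 7)))"
  show "eventually (\<lambda>n. 0 \<le> measure_pmf.prob (random_graph_process n) {xs. bad_graph n (process_graph xs (edge_count n))}) sequentially"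
    by simp
  show "eventually (\<lambda>n. measure_pmf.prob (random_graph_process n) {xs. bad_graph n (process_graph xs (edge_count n))}
      \<le> ?b1 n + ?b2 n) sequentially"
    using eventually_edge_count eventually_many_DD eventually_ge_at_top[of 14]
  proof eventually_elim
    case (elim n)
    let ?m = "edge_count n" and ?A = "Kn_edges n"
    let ?W = "subsets_of_size ?A ?m" and ?C = "real ((n choose 2) choose ?m)"
    have "measure_pmf.prob (random_graph_process n) {xs. bad_graph n (process_graph xs ?m)} =
        real (card {M \<in> ?W. M \<in> Collect (bad_graph n)}) / ?C"
      unfolding random_graph_process_def edge_orderings_eq process_graph_def
      using prob_take_permutation[OF finite_Kn_edges, of ?m n "Collect (bad_graph n)"] elim
      by (simp add: card_Kn_edges)
    also have "{M \<in> ?W. M \<in> Collect (bad_graph n)} =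
        {M \<in> ?W. \<not> locally_sparse M} \<union> {M \<in> ?W. \<not> has_k_copies n 2 DD M}"
      by (auto simp: bad_graph_def)
    also have "real (card \<dots>) / ?C \<le>
        real (card {M \<in> ?W. \<not> locally_sparse M} + card {M \<in> ?W. \<not> has_k_copies n 2 DD M}) / ?C"
      by (intro divide_right_mono) (simp_all only: of_nat_le_iff card_Un_le of_nat_0_le_iff)
    also have "\<dots> = real (card {M \<in> ?W. \<not> locally_sparse M}) / ?C + real (card {M \<in> ?W. \<not> has_k_copies n 2 DD M}) / ?C"
      by (simp only: of_nat_add add_divide_distrib)
    also have "\<dots> \<le> ?b1 n + ?b2 n"
      using not_sparse_bound[of ?m n] few_DD_bound[of "n div 7" n ?m] elim
      unfolding edge_density_def by (intro add_mono) auto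
    finally show ?case .
  qed
qed

lemma prob_tendsto_1:
  assumes "\<And>n xs. xs \<in> edge_orderings n \<Longrightarrow> \<not> bad_graph n (process_graph xs (edge_count n)) \<Longrightarrow> P n xs"
  shows "(\<lambda>n. measure_pmf.prob (random_graph_process n) {xs. P n xs}) \<longlonglongrightarrow> 1"
proof -
  let ?B = "\<lambda>n. {xs. bad_graph n (process_graph xs (edge_count n))}"
  have lower: "1 - measure_pmf.prob (random_graph_process n) (?B n) \<le> measure_pmf.prob (random_graph_process n) {xs. P n xs}" for n
  proof -
    have "set_pmf (random_graph_process n) = edge_orderings n"
      unfolding random_graph_process_def edge_orderings_eq
      by (rule set_pmf_of_set) (simp_all add: permutations_of_set_empty_iff finite_Kn_edges)
    then have "AE xs in random_graph_process n. xs \<in> - ?B n \<longrightarrow> xs \<in> {xs. P n xs}"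
      using assms by (auto simp: AE_measure_pmf_iff)
    then have "measure_pmf.prob (random_graph_process n) (- ?B n) \<le> measure_pmf.prob (random_graph_process n) {xs. P n xs}"
      by (intro measure_pmf.finite_measure_mono_AE) auto
    moreover have "measure_pmf.prob (random_graph_process n) (- ?B n) = 1 - measure_pmf.prob (random_graph_process n) (?B n)"
      using measure_pmf.prob_compl[of "?B n" "random_graph_process n"] by (simp add: Compl_eq_Diff_UNIV)
    ultimately show ?thesis by simp
  qed
  have "(\<lambda>n. 1 - measure_pmf.prob (random_graph_process n) (?B n)) \<longlonglongrightarrow> 1 - 0"
    by (intro tendsto_diff tendsto_const prob_bad_graph_tendsto_0)
  then have lim: "(\<lambda>n. 1 - measure_pmf.prob (random_graph_process n) (?B n)) \<longlonglongrightarrow> 1" by simp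
  show ?thesis
    by (rule tendsto_sandwich[OF always_eventually always_eventually lim tendsto_const])
      (use lower in \<open>simp_all add: measure_pmf.prob_le_1\<close>)
qed

theorem theorem7:
  shows "((\<lambda>n. measure_pmf.prob (random_graph_process n)
            {xs. hitting_time xs (EA_K3 n) = hitting_time xs (has_k_copies n 1 DD)})
           \<longlonglongrightarrow> 1) \<and>
         ((\<lambda>n. measure_pmf.prob (random_graph_process n)
            {xs. hitting_time xs (EE_K3 n) = hitting_time xs (has_k_copies n 2 DD)})
           \<longlonglongrightarrow> 1)"
proof (intro conjI prob_tendsto_1)
  fix n xs assume *: "xs \<in> edge_orderings n" "\<not> bad_graph n (process_graph xs (edge_count n))"
  note eq = hitting_times_eq[OF *(1), of "edge_count n"]
  show "hitting_time xs (EA_K3 n) = hitting_time xs (has_k_copies n 1 DD)"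
    using eq(1) *(2) unfolding bad_graph_def by blast
  show "hitting_time xs (EE_K3 n) = hitting_time xs (has_k_copies n 2 DD)"
    using eq(2) *(2) unfolding bad_graph_def by blast
qed

end
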